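(* Let $d\ge 2$ and let $(G_n(x))_{n=0}^\infty$ be a non-degenerate simple linear recurrence sequence of polynomials of order $d$ with power sum representation $$G_n(x)=a_1\alpha_1^n+a_2\alpha_2^n+\cdots+a_d\alpha_d^n\qquad(n\ge 0),$$ where $a_1,\ldots,a_d\in\mathbb{C}$, $\alpha_1,\ldots,\alpha_d\in\mathbb{C}[x]$, and $\deg\alpha_1>\max\{\deg\alpha_2,\ldots,\deg\alpha_d\}$. Let $m\ge 2$ be an integer and let $m_0$ be the least positive integer such that $\alpha_1^{m_0/m}\in\mathbb{C}[x]$. Then there is an effectively computable positive constant $C$ such that the following holds: there are an integer $l\in\mathbb{N}$, bounded explicitly in terms of $m$, $d$ and $\deg\alpha_1+\cdots+\deg\alpha_d$, and rational functions $\gamma_1,\ldots,\gamma_l\in\mathbb{C}(x)$, given explicitly in terms of $\alpha_1,\ldots,\alpha_d$, where $l$ and the $\gamma_i$ do not depend on $n$, such that whenever for some $n\in\mathbb{N}$ with $n>C$ we have $G_n(x)=g\circ h$ with $g,h\in\mathbb{C}[x]$, $\deg g=m$ and $\deg h>1$, then $n=m_0\ell$ for some $\ell\in\mathbb{N}$ and there are $c_1,\ldots,c_l\in\mathbb{C}$ with $$h(x)=c_1\gamma_1^\ell+\cdots+c_l\gamma_l^\ell.$$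
   Context: The sequence satisfies a recurrence $G_{n+d}=A_{d-1}G_{n+d-1}+\cdots+A_0G_n$ with $A_i\in\mathbb{C}[x]$ whose characteristic polynomial $T^d-A_{d-1}T^{d-1}-\cdots-A_0$ has the $d$ pairwise distinct roots $\alpha_1,\ldots,\alpha_d$ ("simple"), all of which are polynomials; "order $d$" means the representation genuinely involves all $d$ roots (each $a_i\neq 0$), and "non-degenerate" means that $\alpha_i/\alpha_j\notin\mathbb{C}$ for $i\neq j$. The expression $\alpha_1^{m_0/m}\in\mathbb{C}[x]$ means that $\psi^{m_0}\in\mathbb{C}[x]$ where $\psi$ is an $m$-th root of $\alpha_1$ (so $m_0$ divides $m$). $g\circ h$ denotes the composition $g(h(x))$. *)

theory Defs
  imports "HOL-Algebra.Algebraic_Closure_Type"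
begin

abbreviation const_fract :: "complex \<Rightarrow> complex poly fract" where
  "const_fract c \<equiv> to_fract [:c:]"

abbreviation poly_to_ac :: "complex poly \<Rightarrow> complex poly fract alg_closure" where
  "poly_to_ac p \<equiv> to_ac (to_fract p)"

text \<open>
  Fractional powers: if \<open>\<psi> ^ m = \<alpha>\<close> then \<open>\<psi> ^ k\<close> is \<open>\<alpha>\<^bsup>k/m\<^esup>\<close>, and the least \<open>k > 0\<close> for which this is a
  polynomial does not depend on the choice of the root \<open>\<psi>\<close>.
\<close>

definition least_poly_power :: "complex poly fract alg_closure \<Rightarrow> nat" where
  "least_poly_power \<psi> = (LEAST k. k > 0 \<and> \<psi> ^ k \<in> range poly_to_ac)"

definition linear_recurrence ::
    "nat \<Rightarrow> (nat \<Rightarrow> complex poly) \<Rightarrow> (nat \<Rightarrow> complex poly) \<Rightarrow> bool" where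
  "linear_recurrence d A G \<longleftrightarrow> (\<forall>n. G (n + d) = (\<Sum>i<d. A i * G (n + i)))"

definition characteristic_poly :: "nat \<Rightarrow> (nat \<Rightarrow> complex poly) \<Rightarrow> complex poly poly" where
  "characteristic_poly d A = monom 1 d - (\<Sum>i<d. monom (A i) i)"

text \<open>
  The coefficients \<open>A\<close> are indexed by \<open>0, \<dots>, d - 1\<close>, while \<open>a\<close> and the roots \<open>\<alpha>\<close> are indexed
  by \<open>1, \<dots>, d\<close>.  The characteristic polynomial is monic of degree \<open>d\<close>, so \<open>d\<close> distinct roots
  are all its roots.  Since \<open>0\<close> is a constant and \<open>y / 0 = 0\<close>, the condition on the quotients
  forces all \<open>\<alpha> i\<close> to be nonzero when \<open>d \<ge> 2\<close>.
\<close>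

definition nondegenerate_simple_lrs ::
    "nat \<Rightarrow> (nat \<Rightarrow> complex poly) \<Rightarrow> (nat \<Rightarrow> complex poly) \<Rightarrow>
     (nat \<Rightarrow> complex) \<Rightarrow> (nat \<Rightarrow> complex poly) \<Rightarrow> bool" where
  "nondegenerate_simple_lrs d A G a \<alpha> \<longleftrightarrow>
     linear_recurrence d A G \<and>
     inj_on \<alpha> {1..d} \<and>
     (\<forall>i\<in>{1..d}. poly (characteristic_poly d A) (\<alpha> i) = 0) \<and>
     (\<forall>n. G n = (\<Sum>i=1..d. smult (a i) (\<alpha> i ^ n))) \<and>
     (\<forall>i\<in>{1..d}. a i \<noteq> 0) \<and>
     (\<forall>i\<in>{1..d}. \<forall>j\<in>{1..d}. i \<noteq> j \<longrightarrow>
        to_fract (\<alpha> i) / to_fract (\<alpha> j) \<notin> range const_fract)"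

text \<open>
  The \<open>k\<close>-ary total recursive functions: the least class containing the basic functions and
  closed under composition, primitive recursion and minimization of regular functions.
  Arguments are passed as lists; the values on lists of length other than \<open>k\<close> are irrelevant.
\<close>

inductive total_recursive :: "nat \<Rightarrow> (nat list \<Rightarrow> nat) \<Rightarrow> bool" where
  zero: "total_recursive k (\<lambda>_. 0)"
| succ: "total_recursive 1 (\<lambda>xs. Suc (xs ! 0))"
| proj: "i < k \<Longrightarrow> total_recursive k (\<lambda>xs. xs ! i)"
| comp: "total_recursive (length fs) g \<Longrightarrow> (\<forall>f\<in>set fs. total_recursive k f) \<Longrightarrow>
    total_recursive k (\<lambda>xs. g (map (\<lambda>f. f xs) fs))"
| prec: "total_recursive k f \<Longrightarrow> total_recursive (k + 2) g \<Longrightarrow>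
    total_recursive (k + 1) (\<lambda>xs. rec_nat (f (tl xs)) (\<lambda>i r. g (i # r # tl xs)) (hd xs))"
| minim: "total_recursive (k + 1) f \<Longrightarrow> (\<forall>xs. length xs = k \<longrightarrow> (\<exists>y. f (y # xs) = 0)) \<Longrightarrow>
    total_recursive k (\<lambda>xs. LEAST y. f (y # xs) = 0)"

definition total_recursive_int :: "nat \<Rightarrow> (nat list \<Rightarrow> int) \<Rightarrow> bool" where
  "total_recursive_int k e \<longleftrightarrow>
     (\<exists>p q. total_recursive k p \<and> total_recursive k q \<and> e = (\<lambda>xs. int (p xs) - int (q xs)))"

end

theory Submission
  imports Defs
begin

text \<open>
  Write \<open>N = deg h\<close> and complete the power: \<open>g(h) = b (h - c)\<^sup>m + q(h)\<close> with \<open>deg q \<le> m - 2\<close>. Hence, in the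
  Laurent series in \<open>1/x\<close>, \<open>h - c\<close> agrees with an \<open>m\<close>-th root of \<open>G\<^sub>n/b\<close> up to an error of degree at most
  \<open>- N\<close>. Up to an error of the same size, the binomial series turns this root into
  \<open>u T(\<epsilon>)\<close>, where \<open>u\<^sup>m\<close> is a constant multiple of \<open>\<alpha>\<^sub>1\<^sup>n\<close>, \<open>T\<close> is a polynomial and
  \<open>\<epsilon> = (G\<^sub>n - a\<^sub>1 \<alpha>\<^sub>1\<^sup>n) / (a\<^sub>1 \<alpha>\<^sub>1\<^sup>n)\<close>. So \<open>h\<close> is very close to the span of \<open>1\<close> and boundedly many terms
  \<open>u r\<close>, each \<open>r\<close> being an \<open>n\<close>-th power of a monomial in the \<open>\<alpha>\<^sub>j\<^bsup>\<plusminus>1\<^esup>\<close>. The logarithmic derivatives of these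
  terms have height bounded independently of \<open>n\<close>, so first order differential operators of bounded degree
  annihilate them one after another; applied to \<open>h\<close> they leave a polynomial of negative degree. Therefore
  \<open>h\<close> lies in the span. As \<open>h\<close> is not constant and every nonconstant generator is \<open>u\<close> times a rational
  function, \<open>u\<close> is a rational function, and so is \<open>\<psi>\<^sup>n\<close>, which means that \<open>m\<^sub>0\<close> divides \<open>n\<close>.
\<close>

section \<open>Total recursive functions and digit expansions\<close>

text \<open>\<open>total_recursive\<close> fixes the values on lists of every length. Asking for
  agreement on lists of length \<open>k\<close> only makes the class closed under rewriting a
  function on its actual arguments.\<close>

definition recursive_fun :: "nat \<Rightarrow> (nat list \<Rightarrow> nat) \<Rightarrow> bool" where
  "recursive_fun k f \<longleftrightarrow> (\<exists>g. total_recursive k g \<and> (\<forall>xs. length xs = k \<longrightarrow> g xs = f xs))"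

lemma recursive_fun_proj: "i < k \<Longrightarrow> recursive_fun k (\<lambda>xs. xs ! i)"
  unfolding recursive_fun_def by (blast intro: total_recursive.proj)

lemma recursive_fun_comp:
  assumes "recursive_fun (length fs) g" "\<And>f. f \<in> set fs \<Longrightarrow> recursive_fun k f"
  shows "recursive_fun k (\<lambda>xs. g (map (\<lambda>f. f xs) fs))"
proof -
  obtain g' where g': "total_recursive (length fs) g'" "\<And>xs. length xs = length fs \<Longrightarrow> g' xs = g xs"
    using assms(1) unfolding recursive_fun_def by blast
  have "\<forall>f\<in>set fs. \<exists>f'. total_recursive k f' \<and> (\<forall>xs. length xs = k \<longrightarrow> f' xs = f xs)"
    using assms(2) unfolding recursive_fun_def by blast
  then obtain F where F: "\<forall>f\<in>set fs. total_recursive k (F f) \<and> (\<forall>xs. length xs = k \<longrightarrow> F f xs = f xs)"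
    by metis
  have "total_recursive k (\<lambda>xs. g' (map (\<lambda>f. f xs) (map F fs)))"
    by (rule total_recursive.comp) (use g' F in auto)
  moreover have "g' (map (\<lambda>f. f xs) (map F fs)) = g (map (\<lambda>f. f xs) fs)" if "length xs = k" for xs
  proof -
    have "map (\<lambda>f. f xs) (map F fs) = map (\<lambda>f. f xs) fs" using F that by auto
    then show ?thesis using g'(2) by (metis length_map)
  qed
  ultimately show ?thesis unfolding recursive_fun_def by blast
qed

lemma recursive_fun_comp1:
  assumes "recursive_fun 1 (\<lambda>xs. g (xs ! 0))" "recursive_fun k f"
  shows "recursive_fun k (\<lambda>xs. g (f xs))"
  using recursive_fun_comp[of "[f]" "\<lambda>xs. g (xs ! 0)" k] assms by simp

lemma recursive_fun_comp2:
  assumes "recursive_fun 2 (\<lambda>xs. g (xs ! 0) (xs ! 1))" "recursive_fun k f1" "recursive_fun k f2"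
  shows "recursive_fun k (\<lambda>xs. g (f1 xs) (f2 xs))"
proof -
  have "recursive_fun (length [f1, f2]) (\<lambda>xs. g (xs ! 0) (xs ! 1))"
    using assms(1) by (simp add: numeral_2_eq_2)
  from recursive_fun_comp[OF this, of k] assms(2,3) show ?thesis by auto
qed

lemma recursive_fun_prec:
  assumes "recursive_fun k f" "recursive_fun (k + 2) g"
  shows "recursive_fun (k + 1) (\<lambda>xs. rec_nat (f (tl xs)) (\<lambda>i r. g (i # r # tl xs)) (hd xs))"
proof -
  obtain f' where f': "total_recursive k f'" "\<And>xs. length xs = k \<Longrightarrow> f' xs = f xs"
    using assms(1) unfolding recursive_fun_def by blast
  obtain g' where g': "total_recursive (k + 2) g'" "\<And>xs. length xs = k + 2 \<Longrightarrow> g' xs = g xs"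
    using assms(2) unfolding recursive_fun_def by blast
  have "rec_nat (f' (tl xs)) (\<lambda>i r. g' (i # r # tl xs)) n = rec_nat (f (tl xs)) (\<lambda>i r. g (i # r # tl xs)) n"
    if "length xs = k + 1" for xs n
    using that f'(2) g'(2) by (induction n) simp_all
  then show ?thesis
    unfolding recursive_fun_def using total_recursive.prec[OF f'(1) g'(1)] by blast
qed

lemma recursive_fun_cong:
  assumes "recursive_fun k f" "\<And>xs. length xs = k \<Longrightarrow> f xs = g xs"
  shows "recursive_fun k g"
  using assms unfolding recursive_fun_def by metis

lemma recursive_fun_Suc:
  assumes "recursive_fun k f"
  shows "recursive_fun k (\<lambda>xs. Suc (f xs))"
  by (rule recursive_fun_comp1[OF _ assms])
    (unfold recursive_fun_def, use total_recursive.succ in blast)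

lemma recursive_fun_const: "recursive_fun k (\<lambda>_. c)"
proof (induction c)
  case 0
  then show ?case unfolding recursive_fun_def using total_recursive.zero by blast
qed (rule recursive_fun_Suc)

lemma length_2_cases: "length xs = 2 \<Longrightarrow> (\<And>x y. xs = [x, y] \<Longrightarrow> P) \<Longrightarrow> P"
  by (auto simp: numeral_2_eq_2 length_Suc_conv)

text \<open>Addition, multiplication, powers, predecessor and truncated subtraction are all
  recursions with a single parameter and are obtained as instances.\<close>

lemma recursive_fun_rec1:
  assumes "recursive_fun 3 (\<lambda>xs. g (xs ! 0) (xs ! 1) (xs ! 2))" "recursive_fun 1 (\<lambda>xs. f (xs ! 0))"
    "recursive_fun k h1" "recursive_fun k h2"
  shows "recursive_fun k (\<lambda>xs. rec_nat (f (h2 xs)) (\<lambda>i r. g i r (h2 xs)) (h1 xs))"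
proof (rule recursive_fun_comp2[OF _ assms(3,4), of "\<lambda>x y. rec_nat (f y) (\<lambda>i r. g i r y) x"])
  have "recursive_fun (1 + 1) (\<lambda>xs. rec_nat (f (tl xs ! 0))
     (\<lambda>i r. g ((i # r # tl xs) ! 0) ((i # r # tl xs) ! 1) ((i # r # tl xs) ! 2)) (hd xs))"
    by (rule recursive_fun_prec) (use assms in \<open>simp_all add: numeral_3_eq_3 numeral_2_eq_2\<close>)
  then have "recursive_fun 2 (\<lambda>xs. rec_nat (f (tl xs ! 0))
     (\<lambda>i r. g ((i # r # tl xs) ! 0) ((i # r # tl xs) ! 1) ((i # r # tl xs) ! 2)) (hd xs))"
    by (simp add: numeral_2_eq_2)
  then show "recursive_fun 2 (\<lambda>xs. rec_nat (f (xs ! 1)) (\<lambda>i r. g i r (xs ! 1)) (xs ! 0))"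
    by (rule recursive_fun_cong) (auto elim!: length_2_cases)
qed

lemma recursive_fun_add:
  assumes "recursive_fun k f" "recursive_fun k g"
  shows "recursive_fun k (\<lambda>xs. f xs + g xs)"
proof -
  have "recursive_fun k (\<lambda>xs. rec_nat (g xs) (\<lambda>i r. Suc r) (f xs))"
    by (rule recursive_fun_rec1[OF _ _ assms, where f = "\<lambda>x. x" and g = "\<lambda>_ r _. Suc r"])
      (intro recursive_fun_Suc recursive_fun_proj; simp)+
  moreover have "rec_nat y (\<lambda>i r. Suc r) x = x + y" for x y by (induction x) auto
  ultimately show ?thesis by simp
qed

lemma recursive_fun_mult:
  assumes "recursive_fun k f" "recursive_fun k g"
  shows "recursive_fun k (\<lambda>xs. f xs * g xs)"
proof -
  have "recursive_fun k (\<lambda>xs. rec_nat 0 (\<lambda>i r. g xs + r) (f xs))"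
    by (rule recursive_fun_rec1[OF _ _ assms, where f = "\<lambda>x. 0" and g = "\<lambda>_ r y. y + r"])
      (intro recursive_fun_add recursive_fun_const recursive_fun_proj; simp)+
  moreover have "rec_nat 0 (\<lambda>i r. y + r) x = x * y" for x y :: nat by (induction x) auto
  ultimately show ?thesis by simp
qed

lemma recursive_fun_power:
  assumes "recursive_fun k f" "recursive_fun k g"
  shows "recursive_fun k (\<lambda>xs. f xs ^ g xs)"
proof -
  have "recursive_fun k (\<lambda>xs. rec_nat 1 (\<lambda>i r. f xs * r) (g xs))"
    by (rule recursive_fun_rec1[OF _ _ assms(2,1), where f = "\<lambda>x. 1" and g = "\<lambda>_ r y. y * r"])
      (intro recursive_fun_mult recursive_fun_const recursive_fun_proj; simp)+
  moreover have "rec_nat 1 (\<lambda>i r. y * r) x = y ^ x" for x y :: nat by (induction x) auto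
  ultimately show ?thesis by simp
qed

lemma recursive_fun_diff:
  assumes "recursive_fun k f" "recursive_fun k g"
  shows "recursive_fun k (\<lambda>xs. f xs - g xs)"
proof -
  have pred: "recursive_fun k (\<lambda>xs. f xs - 1)" if "recursive_fun k f" for k f
  proof -
    have "recursive_fun k (\<lambda>xs. rec_nat 0 (\<lambda>i r. i) (f xs))"
      by (rule recursive_fun_rec1[OF _ _ that that, where f = "\<lambda>x. 0" and g = "\<lambda>i _ _. i"])
        (intro recursive_fun_const recursive_fun_proj; simp)+
    moreover have "rec_nat 0 (\<lambda>i r. i) x = x - 1" for x :: nat by (cases x) auto
    ultimately show ?thesis by simp
  qed
  have "recursive_fun k (\<lambda>xs. rec_nat (f xs) (\<lambda>i r. r - 1) (g xs))"
    by (rule recursive_fun_rec1[OF _ _ assms(2,1), where f = "\<lambda>x. x" and g = "\<lambda>_ r y. r - 1"])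
      (intro pred recursive_fun_proj; simp)+
  moreover have "rec_nat y (\<lambda>i r. r - 1) x = y - x" for x y :: nat by (induction x) auto
  ultimately show ?thesis by simp
qed

lemma recursive_fun_div:
  assumes "recursive_fun k f" "recursive_fun k g"
  shows "recursive_fun k (\<lambda>xs. f xs div g xs)"
proof (rule recursive_fun_comp2[OF _ assms])
  \<comment> \<open>Minimization over the first argument \<open>q\<close>: for \<open>y > 0\<close>
    the first factor vanishes exactly when \<open>x < (q + 1) * y\<close>. The second factor makes
    \<open>q = 0\<close> a zero when \<open>y = 0\<close>, in agreement with
    \<open>x div 0 = 0\<close>.\<close>
  let ?e = "\<lambda>xs :: nat list. (Suc (xs ! 1) - Suc (xs ! 0) * xs ! 2) * xs ! 2"
  have "recursive_fun 3 ?e"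
    by (intro recursive_fun_mult recursive_fun_diff recursive_fun_Suc recursive_fun_proj) simp_all
  then obtain e where e: "total_recursive 3 e" "\<And>xs. length xs = 3 \<Longrightarrow> e xs = ?e xs"
    unfolding recursive_fun_def by blast
  have eq: "e [q, x, y] = (Suc x - Suc q * y) * y" for q x y
    using e(2)[of "[q, x, y]"] by simp
  have "x < Suc (x div y) * y" if "y > 0" for x y :: nat
    using that by (metis dividend_less_times_div mult.commute mult_Suc_right)
  then have root: "e [x div y, x, y] = 0" for x y
    unfolding eq by (cases "y = 0") (auto simp: Suc_le_eq)
  have least: "x div y \<le> q" if "e [q, x, y] = 0" for x y q
    using that unfolding eq by (cases "y = 0")
      (auto simp: less_Suc_eq_le[symmetric] div_less_iff_less_mult simp del: mult_Suc)
  have "total_recursive 2 (\<lambda>xs. LEAST y. e (y # xs) = 0)"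
    by (rule total_recursive.minim)
      (use e(1) root in \<open>auto simp: numeral_3_eq_3 numeral_2_eq_2 length_Suc_conv\<close>)
  moreover have "(LEAST q. e (q # xs) = 0) = xs ! 0 div xs ! 1" if "length xs = 2" for xs
    using that by (rule length_2_cases) (auto intro!: Least_equality root least)
  ultimately show "recursive_fun 2 (\<lambda>xs. xs ! 0 div xs ! 1)"
    unfolding recursive_fun_def by blast
qed

lemma recursive_fun_mod:
  assumes "recursive_fun k f" "recursive_fun k g"
  shows "recursive_fun k (\<lambda>xs. f xs mod g xs)"
  unfolding minus_div_mult_eq_mod[symmetric]
  by (intro recursive_fun_diff recursive_fun_mult recursive_fun_div assms)

lemma recursive_fun_if_eq:
  assumes "recursive_fun k f" "recursive_fun k g" "recursive_fun k s" "recursive_fun k t"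
  shows "recursive_fun k (\<lambda>xs. if f xs = g xs then s xs else t xs)"
proof -
  \<comment> \<open>The two truncated differences add up to the distance of \<open>f xs\<close> and
    \<open>g xs\<close>, so 1 minus this sum is the 0/1 indicator of equality.\<close>
  have "recursive_fun k (\<lambda>xs. (1 - ((f xs - g xs) + (g xs - f xs))) * s xs +
    (1 - (1 - ((f xs - g xs) + (g xs - f xs)))) * t xs)"
    by (intro recursive_fun_diff recursive_fun_mult recursive_fun_add recursive_fun_const assms)
  then show ?thesis by (rule recursive_fun_cong) auto
qed

lemmas recursive_fun_intros =
  recursive_fun_Suc recursive_fun_add recursive_fun_mult recursive_fun_power recursive_fun_diff
  recursive_fun_div recursive_fun_mod recursive_fun_if_eq recursive_fun_const recursive_fun_proj

section \<open>Digit expansions of indices\<close>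

definition digit :: "nat \<Rightarrow> nat \<Rightarrow> nat \<Rightarrow> nat" where
  "digit M i j = i div M ^ j mod M"

lemma ex_digits:
  assumes "\<And>j. j \<le> d \<Longrightarrow> e j < M"
  shows "\<exists>i\<in>{1..M ^ (d + 1)}. \<forall>j\<le>d. digit M i j = e j"
proof -
  have "\<exists>i<M ^ (d + 1). \<forall>j\<le>d. digit M i j = e j"
    using assms
  proof (induction d)
    case 0
    then show ?case by (intro exI[of _ "e 0"]) (auto simp: digit_def)
  next
    case (Suc d)
    then obtain i where i: "i < M ^ (d + 1)" "\<forall>j\<le>d. digit M i j = e j" by force
    let ?i = "i + M ^ (d + 1) * e (Suc d)"
    have M: "M > 0" using Suc.prems[of 0] by simp
    have "Suc (e (Suc d)) \<le> M" using Suc.prems[of "Suc d"] by simp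
    then have "M ^ (d + 1) * Suc (e (Suc d)) \<le> M ^ (d + 1) * M" by (rule mult_le_mono2)
    then have "?i < M ^ (Suc d + 1)" using i(1) by (simp add: algebra_simps)
    moreover have "digit M ?i j = e j" if j: "j \<le> Suc d" for j
    proof (cases "j = Suc d")
      case True
      then show ?thesis using i(1) Suc.prems[of "Suc d"] M by (simp add: digit_def)
    next
      case False
      then have "j \<le> d" using j by simp
      then have "M ^ (d + 1) = M ^ j * (M * M ^ (d - j))"
        by (metis Suc_eq_plus1 Suc_diff_le le_add_diff_inverse le_SucI power_Suc power_add)
      then have "?i = i + M ^ j * (M * (M ^ (d - j) * e (Suc d)))" by (simp only: mult.assoc)
      moreover have "(i + M ^ j * z) div M ^ j = z + i div M ^ j" for z using M by simp
      ultimately have "?i div M ^ j = M * (M ^ (d - j) * e (Suc d)) + i div M ^ j" by presburger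
      then show ?thesis using i(2) \<open>j \<le> d\<close> by (simp add: digit_def)
    qed
    ultimately show ?case by blast
  qed
  then obtain i where i: "i < M ^ (d + 1)" "\<forall>j\<le>d. digit M i j = e j" by blast
  show ?thesis
  proof (cases "i = 0")
    case False
    then show ?thesis using i by (intro bexI[of _ i]) auto
  next
    case True
    have M: "M > 0" using assms[of 0] by simp
    have "digit M (M ^ (d + 1)) j = 0" if "j \<le> d" for j
    proof -
      have "M ^ (d + 1) = M ^ j * (M * M ^ (d - j))"
        using that by (metis Suc_eq_plus1 Suc_diff_le le_add_diff_inverse le_SucI power_Suc power_add)
      then show ?thesis using M by (simp add: digit_def)
    qed
    moreover have "digit M 0 j = 0" for j by (simp add: digit_def)
    ultimately show ?thesis using i M True by (intro bexI[of _ "M ^ (d + 1)"]) auto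
  qed
qed

section \<open>Laurent expansions at infinity\<close>

unbundle fps_syntax

text \<open>For \<open>z = fls_X_inv\<close> the variable of the Laurent series is
  \<open>1/x\<close>, so \<open>at_inf\<close> is the expansion at infinity and degree
  \<open>k\<close> becomes order \<open>-k\<close>.\<close>

definition poly_fls :: "complex fls \<Rightarrow> complex poly \<Rightarrow> complex fls" where
  "poly_fls z p = poly (map_poly fls_const p) z"

abbreviation at_inf :: "complex poly \<Rightarrow> complex fls" where
  "at_inf \<equiv> poly_fls fls_X_inv"

lemma poly_fls_0 [simp]: "poly_fls z 0 = 0"
  by (simp add: poly_fls_def)

lemma poly_fls_pCons [simp]: "poly_fls z (pCons c p) = fls_const c + z * poly_fls z p"
  by (cases "c = 0 \<and> p = 0") (auto simp: poly_fls_def map_poly_pCons)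

lemma poly_fls_1 [simp]: "poly_fls z 1 = 1"
  by (simp add: one_pCons)

lemma poly_fls_add [simp]: "poly_fls z (p + q) = poly_fls z p + poly_fls z q"
  by (induction p q rule: poly_induct2) (simp_all add: algebra_simps flip: fls_plus_const)

lemma poly_fls_smult [simp]: "poly_fls z (smult c p) = fls_const c * poly_fls z p"
  by (induction p) (simp_all add: algebra_simps flip: fls_const_mult_const)

lemma poly_fls_uminus [simp]: "poly_fls z (- p) = - poly_fls z p"
  by (induction p) (simp_all add: algebra_simps)

lemma poly_fls_diff [simp]: "poly_fls z (p - q) = poly_fls z p - poly_fls z q"
  using poly_fls_add[of z p "- q"] by simp

lemma poly_fls_mult [simp]: "poly_fls z (p * q) = poly_fls z p * poly_fls z q"
  by (induction p) (simp_all add: algebra_simps)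

lemma poly_fls_power [simp]: "poly_fls z (p ^ n) = poly_fls z p ^ n"
  by (induction n) simp_all

lemma poly_fls_sum: "poly_fls z (sum f A) = (\<Sum>i\<in>A. poly_fls z (f i))"
  by (induction A rule: infinite_finite_induct) simp_all

lemma at_inf_nth: "at_inf p $$ n = (if n \<le> 0 then coeff p (nat (- n)) else 0)"
proof (induction p arbitrary: n)
  case (pCons a p)
  have "(fls_X_inv * at_inf p) $$ n = at_inf p $$ (n + 1)"
    by (simp add: fls_X_inv_times_conv_shift)
  then show ?case using pCons.IH[of "n + 1"]
    by (cases "n < 0")
      (auto simp: coeff_pCons nat_diff_distrib Suc_nat_eq_nat_zadd1 split: nat.splits
        intro!: arg_cong[of _ _ "coeff p"])
qed simp

lemma at_inf_eq_iff [simp]: "at_inf p = at_inf q \<longleftrightarrow> p = q"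
proof
  assume eq: "at_inf p = at_inf q"
  show "p = q"
  proof (rule poly_eqI)
    fix n
    show "coeff p n = coeff q n"
      using arg_cong[OF eq, of "\<lambda>f. f $$ (- int n)"] by (simp add: at_inf_nth)
  qed
qed simp

lemma at_inf_eq_0_iff [simp]: "at_inf p = 0 \<longleftrightarrow> p = 0"
  using at_inf_eq_iff[of p 0] by (simp del: at_inf_eq_iff)

text \<open>Vanishing coefficients are used rather than \<open>fls_subdegree\<close>, whose value at
  the zero series is 0; in this form the zero series has every order.\<close>

definition order_ge :: "int \<Rightarrow> complex fls \<Rightarrow> bool" where
  "order_ge k f \<longleftrightarrow> (\<forall>i<k. f $$ i = 0)"

lemma order_ge_mono: "order_ge k f \<Longrightarrow> j \<le> k \<Longrightarrow> order_ge j f"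
  by (auto simp: order_ge_def)

lemma order_ge_0 [simp]: "order_ge k 0"
  by (simp add: order_ge_def)

lemma order_ge_const [simp]: "order_ge 0 (fls_const c)"
  by (simp add: order_ge_def)

lemma order_ge_1 [simp]: "order_ge 0 1"
  by (simp add: order_ge_def)

lemma order_ge_add: "order_ge k f \<Longrightarrow> order_ge k g \<Longrightarrow> order_ge k (f + g)"
  by (simp add: order_ge_def)

lemma order_ge_diff: "order_ge k f \<Longrightarrow> order_ge k g \<Longrightarrow> order_ge k (f - g)"
  by (simp add: order_ge_def)

lemma order_ge_uminus: "order_ge k f \<Longrightarrow> order_ge k (- f)"
  by (simp add: order_ge_def)

lemma order_ge_sum: "(\<And>i. i \<in> A \<Longrightarrow> order_ge k (f i)) \<Longrightarrow> order_ge k (sum f A)"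
  by (induction A rule: infinite_finite_induct) (auto intro: order_ge_add)

lemma order_ge_iff: "order_ge k f \<longleftrightarrow> f = 0 \<or> k \<le> fls_subdegree f"
  by (metis fls_eq0_below_subdegree fls_subdegree_geI nth_fls_subdegree_nonzero not_le_imp_less
      order_ge_0 order_ge_def order_less_le_trans)

lemma order_ge_mult: "order_ge j f \<Longrightarrow> order_ge k g \<Longrightarrow> order_ge (j + k) (f * g)"
  by (cases "f = 0 \<or> g = 0") (auto simp: order_ge_iff)

lemma order_ge_power: "order_ge k f \<Longrightarrow> order_ge (int n * k) (f ^ n)"
  by (cases "f = 0"; cases "n = 0") (auto simp: order_ge_iff fls_subdegree_pow intro!: mult_left_mono)

lemma order_ge_at_inf: "degree p \<le> n \<Longrightarrow> order_ge (- int n) (at_inf p)"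
  by (auto simp: order_ge_def at_inf_nth intro!: coeff_eq_0)

text \<open>The expansion of a polynomial has no positive powers of \<open>1/x\<close>. This is what
  turns an error estimate into an exact equation.\<close>

lemma at_inf_order_pos: "order_ge 1 (at_inf p) \<Longrightarrow> p = 0"
proof (rule poly_eqI)
  fix n assume "order_ge 1 (at_inf p)"
  then have "at_inf p $$ (- int n) = 0" by (simp add: order_ge_def)
  then show "coeff p n = coeff 0 n" by (simp add: at_inf_nth)
qed

lemma fls_subdegree_at_inf: "fls_subdegree (at_inf p) = - int (degree p)"
proof (cases "p = 0")
  case False
  then show ?thesis
    by (intro fls_subdegree_eqI) (auto simp: at_inf_nth intro!: coeff_eq_0)
qed simp

text \<open>Under \<open>x = 1/X\<close> the derivation \<open>d/dx\<close> becomes \<open>- X\<^sup>2 d/dX\<close>.\<close>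

definition deriv_x :: "complex fls \<Rightarrow> complex fls" where
  "deriv_x f = - (fls_X ^ 2 * fls_deriv f)"

lemma deriv_x_add: "deriv_x (f + g) = deriv_x f + deriv_x g"
  by (simp add: deriv_x_def algebra_simps)

lemma deriv_x_mult: "deriv_x (f * g) = deriv_x f * g + f * deriv_x g"
  by (simp add: deriv_x_def algebra_simps)

lemma deriv_x_const [simp]: "deriv_x (fls_const c) = 0"
  by (simp add: deriv_x_def)

lemma deriv_x_1 [simp]: "deriv_x 1 = 0"
  by (simp add: deriv_x_def)

lemma deriv_x_0 [simp]: "deriv_x 0 = 0"
  by (simp add: deriv_x_def)

lemma deriv_x_eq_0: "deriv_x f = 0 \<Longrightarrow> \<exists>c. f = fls_const c"
  by (auto simp: deriv_x_def fls_deriv_eq_0_iff)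

lemma deriv_x_X_inv: "deriv_x fls_X_inv = 1"
proof -
  have "fls_X * fls_X_inv = (1 :: complex fls)" by (simp add: fls_X_times_conv_shift)
  then have "(fls_X * fls_X_inv)\<^sup>2 = (1 :: complex fls)" by simp
  then show ?thesis by (simp add: deriv_x_def power_mult_distrib)
qed

lemma deriv_x_at_inf: "deriv_x (at_inf p) = at_inf (pderiv p)"
  by (induction p) (simp_all add: deriv_x_add deriv_x_mult deriv_x_X_inv pderiv_pCons)

lemma order_ge_deriv_x: "order_ge k f \<Longrightarrow> order_ge k (deriv_x f)"
proof -
  assume "order_ge k f"
  then have "order_ge (k - 1) (fls_deriv f)" by (auto simp: order_ge_def)
  moreover have "order_ge 2 (fls_X ^ 2)" by (simp add: order_ge_iff)
  ultimately have "order_ge (2 + (k - 1)) (fls_X ^ 2 * fls_deriv f)" by (intro order_ge_mult)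
  then show ?thesis unfolding deriv_x_def by (intro order_ge_uminus) (rule order_ge_mono, auto)
qed

interpretation fls: vector_space "\<lambda>c f. fls_const c * (f :: complex fls)"
  by standard (simp_all add: algebra_simps flip: fls_plus_const fls_const_mult_const)

text \<open>Let \<open>L y = q y' - p y\<close>. From \<open>s' = (p2 / q2) s\<close> follows
  \<open>L s = (N / q2) s\<close> with \<open>N = q p2 - p q2\<close>, so the logarithmic derivative
  of \<open>L s\<close> is formally \<open>N'/N - q2'/q2 + p2/q2\<close>. Over the denominator
  \<open>q2 N\<close> all degrees are at most \<open>3 b\<close>. If \<open>N = 0\<close>, then
  \<open>L s = 0\<close>.\<close>

lemma log_deriv_transform:
  assumes q: "at_inf q * deriv_x t = at_inf p * t" "q \<noteq> 0" "degree q \<le> b" "degree p \<le> b"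
    and q2: "at_inf q2 * deriv_x s = at_inf p2 * s" "q2 \<noteq> 0" "degree q2 \<le> b" "degree p2 \<le> b"
  defines "s1 \<equiv> at_inf q * deriv_x s - at_inf p * s"
  shows "\<exists>q p. q \<noteq> 0 \<and> degree q \<le> 3 * b \<and> degree p \<le> 3 * b \<and>
    at_inf q * deriv_x s1 = at_inf p * s1"
proof -
  define N where "N = q * p2 - p * q2"
  have e1: "at_inf q2 * s1 = at_inf N * s"
    unfolding s1_def N_def using arg_cong[OF q2(1), of "\<lambda>x. at_inf q * x"] by (simp add: algebra_simps)
  show ?thesis
  proof (cases "N = 0")
    case True
    then have "s1 = 0" using e1 q2(2) by simp
    then show ?thesis by (intro exI[of _ 1] exI[of _ 0]) simp
  next
    case False
    have degN: "degree N \<le> 2 * b"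
      unfolding N_def using q q2
      by (intro degree_diff_le order_trans[OF degree_mult_le]) simp_all
    let ?P = "pderiv N * q2 + N * p2 - N * pderiv q2"
    have e2: "at_inf (pderiv q2) * s1 + at_inf q2 * deriv_x s1 =
        at_inf (pderiv N) * s + at_inf N * deriv_x s"
      using arg_cong[OF e1, of deriv_x] by (simp add: deriv_x_mult deriv_x_at_inf)
    have "at_inf q2 * (at_inf (q2 * N) * deriv_x s1) =
        at_inf q2 * (at_inf ?P * s1)"
    proof -
      have "at_inf q2 * (at_inf (q2 * N) * deriv_x s1) =
          at_inf q2 * at_inf N * (at_inf (pderiv N) * s + at_inf N * deriv_x s
            - at_inf (pderiv q2) * s1)"
        by (simp flip: e2)
      also have "\<dots> = at_inf q2 * at_inf (pderiv N) * (at_inf N * s) +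
          at_inf N * at_inf N * (at_inf q2 * deriv_x s) -
          at_inf q2 * at_inf N * at_inf (pderiv q2) * s1"
        by (simp add: algebra_simps)
      also have "\<dots> = at_inf q2 * at_inf (pderiv N) * (at_inf q2 * s1) +
          at_inf N * at_inf p2 * (at_inf q2 * s1) -
          at_inf q2 * at_inf N * at_inf (pderiv q2) * s1"
        unfolding q2(1) e1 by (simp add: algebra_simps)
      also have "\<dots> = at_inf q2 * (at_inf ?P * s1)"
        by (simp add: algebra_simps)
      finally show ?thesis .
    qed
    then have "at_inf (q2 * N) * deriv_x s1 = at_inf ?P * s1"
      using q2(2) by simp
    moreover have "degree (q2 * N) \<le> 3 * b"
      using degN q2 by (intro order_trans[OF degree_mult_le]) simp
    moreover have "degree ?P \<le> 3 * b"
      using degN q2 degree_pderiv[of N] degree_pderiv[of q2]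
      by (intro degree_diff_le degree_add_le order_trans[OF degree_mult_le]) simp_all
    ultimately show ?thesis using False q2(2) by (intro exI[of _ "q2 * N"] exI[of _ ?P]) simp
  qed
qed

text \<open>
  Every operator \<open>y \<mapsto> q y' - p y\<close> maps polynomials to polynomials, annihilates one generator of
  the span and hardly changes the order at infinity.  Once all generators have been annihilated,
  what is left of \<open>f\<close> is a polynomial of negative degree.
\<close>

lemma polynomial_near_span:
  assumes "finite S" "card S \<le> k"
    and "\<And>t. t \<in> S \<Longrightarrow> \<exists>q p. q \<noteq> 0 \<and> degree q \<le> b \<and> degree p \<le> b \<and>
      at_inf q * deriv_x t = at_inf p * t"
    and "at_inf f - R \<in> fls.span S" "order_ge r R" "int b * 4 ^ k < r"
  shows "at_inf f \<in> fls.span S"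
  using assms
proof (induction k arbitrary: S b f R r)
  case 0
  then have "at_inf f = R" by auto
  then have "order_ge 1 (at_inf f)" using 0 by (auto intro: order_ge_mono)
  then have "f = 0" by (rule at_inf_order_pos)
  then show ?case by (simp add: fls.span_zero)
next
  case (Suc k)
  show ?case
  proof (cases "S \<subseteq> {0}")
    case True
    then have "at_inf f - R \<in> fls.span {0}"
      using Suc.prems(4) fls.span_mono by blast
    then have "at_inf f = R" by auto
    moreover have "1 \<le> r" using Suc.prems(6) by (smt (verit) of_nat_0_le_iff zero_le_power mult_nonneg_nonneg)
    ultimately have "order_ge 1 (at_inf f)" using Suc.prems(5) by (auto intro: order_ge_mono)
    then have "f = 0" by (rule at_inf_order_pos)
    then show ?thesis by (simp add: fls.span_zero)
  next
    case False
    then obtain t where t: "t \<in> S" "t \<noteq> 0" by blast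
    define S' where "S' = S - {t}"
    have S: "S = insert t S'" using t by (auto simp: S'_def)
    obtain q p where q: "q \<noteq> 0" "degree q \<le> b" "degree p \<le> b"
        "at_inf q * deriv_x t = at_inf p * t"
      using Suc.prems(3)[OF t(1)] by blast
    define L where "L = (\<lambda>y. at_inf q * deriv_x y - at_inf p * y)"
    interpret L: Vector_Spaces.linear "\<lambda>c f. fls_const c * f" "\<lambda>c f. fls_const c * f" L
      by standard (simp_all add: L_def deriv_x_add deriv_x_mult algebra_simps)
    have Lt: "L t = 0" using q by (simp add: L_def)
    let ?f = "q * pderiv f - p * f"
    have Lf: "L (at_inf f) = at_inf ?f"
      by (simp add: L_def deriv_x_at_inf)
    have "at_inf ?f \<in> fls.span (L ` S')"
    proof (rule Suc.IH)
      show "finite (L ` S')" using Suc.prems(1) by (simp add: S'_def)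
      have "card S' \<le> k" using Suc.prems(1,2) t(1) by (simp add: S'_def)
      then show "card (L ` S') \<le> k"
        using card_image_le[of S' L] Suc.prems(1) by (simp add: S'_def)
      show "\<exists>q p. q \<noteq> 0 \<and> degree q \<le> 3 * b \<and> degree p \<le> 3 * b \<and>
        at_inf q * deriv_x s1 = at_inf p * s1" if s1: "s1 \<in> L ` S'" for s1
      proof -
        obtain s where s: "s \<in> S'" "s1 = L s" using s1 by blast
        then obtain q2 p2 where "q2 \<noteq> 0" "degree q2 \<le> b" "degree p2 \<le> b"
            "at_inf q2 * deriv_x s = at_inf p2 * s"
          using Suc.prems(3)[of s] by (auto simp: S'_def)
        then show ?thesis unfolding s(2) L_def using q by (intro log_deriv_transform)
      qed
      have "L (at_inf f - R) \<in> fls.span (L ` S)"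
        using Suc.prems(4) by (simp add: L.span_image)
      then show "at_inf ?f - L R \<in> fls.span (L ` S')"
        by (simp add: S Lt L.diff Lf)
      have "order_ge (- int b + r) (L R)"
        unfolding L_def using q Suc.prems(5)
        by (intro order_ge_diff order_ge_mult order_ge_at_inf order_ge_deriv_x)
      then show "order_ge (r - int b) (L R)" by simp
      \<comment> \<open>One operator replaces \<open>b\<close> by \<open>3 b\<close> and costs
        \<open>b\<close> in the order \<open>r\<close>. Because
        \<open>3 b 4^k + b \<le> b 4^(k+1)\<close>, a factor 4 per generator leaves enough
        room.\<close>
      have "int b * 1 \<le> int b * 4 ^ k" by (intro mult_left_mono) simp_all
      then show "int (3 * b) * 4 ^ k < r - int b" using Suc.prems(6) by simp
    qed
    then have "at_inf ?f \<in> L ` fls.span S'" by (simp add: L.span_image)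
    then obtain w where w: "w \<in> fls.span S'" "L (at_inf f) = L w" using Lf by auto
    define z where "z = at_inf f - w"
    have "L z = 0" using w by (simp add: z_def L.diff)
    \<comment> \<open>Both \<open>z\<close> and \<open>t\<close> lie in the kernel of the first
      order operator \<open>L\<close>, so their Wronskian vanishes and \<open>z / t\<close> is
      constant.\<close>
    have "at_inf q * (deriv_x z * t - z * deriv_x t) = L z * t - z * L t"
      by (simp add: L_def algebra_simps)
    then have "deriv_x z * t = z * deriv_x t" using \<open>L z = 0\<close> Lt q(1) by simp
    moreover have "deriv_x z = deriv_x (z / t) * t + z / t * deriv_x t"
      using deriv_x_mult[of "z / t" t] t(2) by simp
    ultimately have "deriv_x (z / t) * t * t = 0" using t(2) by (simp add: field_simps)
    then have "deriv_x (z / t) = 0" using t(2) by simp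
    then obtain c where "z / t = fls_const c" using deriv_x_eq_0 by blast
    then have "z = fls_const c * t" using t(2) by (simp add: field_simps)
    then have "at_inf f - fls_const c * t \<in> fls.span S'" using w by (simp add: z_def algebra_simps)
    then show ?thesis unfolding S fls.span_breakdown_eq by blast
  qed
qed

section \<open>Expansion of the root\<close>

lemma order_ge_divide:
  assumes "order_ge k f" "g \<noteq> 0"
  shows "order_ge (k - fls_subdegree g) (f / g)"
  using order_ge_mult[of k f "- fls_subdegree g" "inverse g"] assms
  by (simp add: order_ge_iff divide_inverse)

lemma order_ge_poly_fls: "order_ge 0 z \<Longrightarrow> order_ge 0 (poly_fls z p)"
  by (induction p) (auto intro!: order_ge_add order_ge_mult[of 0 _ 0, simplified])

lemma order_ge_poly_fls_1:
  assumes "order_ge 1 z" "coeff p 0 = 1"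
  shows "order_ge 1 (poly_fls z p - 1)"
proof (cases p)
  case (pCons a q)
  have "order_ge (1 + 0) (z * poly_fls z q)"
    by (intro order_ge_mult order_ge_poly_fls assms order_ge_mono[OF assms(1)]) simp
  then show ?thesis using assms pCons by simp
qed

lemma one_unit_order_ge_0: "order_ge 1 (f - 1) \<Longrightarrow> order_ge 0 f"
  using order_ge_add[of 0 "f - 1" 1] by (simp add: order_ge_mono)

lemma one_unit_mult:
  assumes "order_ge 1 (f - 1)" "order_ge 1 (g - 1)"
  shows "order_ge 1 (f * g - 1)"
proof -
  have "order_ge (1 + 0) ((f - 1) * g)"
    using assms by (intro order_ge_mult one_unit_order_ge_0)
  then have "order_ge 1 ((f - 1) * g + (g - 1))" using assms by (intro order_ge_add) simp_all
  then show ?thesis by (simp add: algebra_simps)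
qed

lemma one_unit_power: "order_ge 1 (f - 1) \<Longrightarrow> order_ge 1 (f ^ n - 1)"
  by (induction n) (simp_all add: one_unit_mult)

lemma near_const_unit:
  assumes "order_ge 1 (f - fls_const c)" "c \<noteq> 0"
  shows "f \<noteq> 0" "fls_subdegree f = 0"
proof -
  have nth: "f $$ i = (if i = 0 then c else 0)" if "i < 1" for i
    using assms(1) that unfolding order_ge_def by (metis eq_iff_diff_eq_0 fls_const_nth fls_minus_nth)
  then have "f $$ 0 \<noteq> 0" using assms(2) by simp
  then show "f \<noteq> 0" by auto
  show "fls_subdegree f = 0" by (rule fls_subdegree_eqI) (use nth assms(2) in auto)
qed

lemma one_unit_root:
  assumes "order_ge 1 (W - 1)" "m > 0"
  obtains v where "v ^ m = W" "order_ge 1 (v - 1)"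
proof -
  have W: "W \<noteq> 0" "fls_subdegree W = 0"
    using near_const_unit[of W 1] assms by simp_all
  define w where "w = fls_regpart W"
  have w: "W = fps_to_fls w" unfolding w_def using W by simp
  have w0: "w $ 0 = 1" using assms(1) unfolding order_ge_def w
    by (auto dest: spec[of _ 0])
  obtain k where m: "m = Suc k" using assms(2) by (cases m) auto
  \<comment> \<open>The root chosen for the constant coefficient 1 is 1, so \<open>v\<close> is
    again 1 plus terms of positive order.\<close>
  define v where "v = fps_radical (\<lambda>_ _. 1) m w"
  have "v ^ m = w"
    unfolding v_def m using power_radical[of w "\<lambda>_ _. 1" k] w0 by simp
  moreover have "v $ 0 = 1" unfolding v_def m by simp
  ultimately show ?thesis using that[of "fps_to_fls v"]
    by (auto simp: w order_ge_def fps_to_fls_power[symmetric])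
qed

text \<open>The remainder is quadratic in \<open>b\<close>, which is what a Newton step needs in
  order to correct one more coefficient of an approximate root.\<close>

lemma power_add_first_order:
  fixes a b :: "'a :: comm_ring_1"
  shows "\<exists>z. (a + b) ^ m = a ^ m + of_nat m * b * a ^ (m - 1) + b ^ 2 * z"
proof (induction m)
  case (Suc m)
  then obtain z where z: "(a + b) ^ m = a ^ m + of_nat m * b * a ^ (m - 1) + b ^ 2 * z" by blast
  have "a * (of_nat m * b * a ^ (m - 1)) = of_nat m * b * a ^ m"
    by (cases m) (simp_all add: algebra_simps)
  then show ?case
    by (intro exI[of _ "of_nat m * a ^ (m - 1) + a * z + b * z"])
      (simp add: z algebra_simps power2_eq_square)
qed (auto intro: exI[of _ 0])

text \<open>\<open>T\<close> is the binomial series of \<open>(1 + X)^(1/m)\<close> cut off after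
  degree \<open>K\<close>. In the step, adding \<open>c X^(K+1)\<close> changes the coefficient of
  \<open>X^(K+1)\<close> in the error by \<open>m c\<close>, because \<open>T\<close> has constant
  term 1, and \<open>c\<close> is chosen to cancel it; the quadratic remainder is divisible by
  \<open>X^(2K+2)\<close>.\<close>

lemma truncated_root:
  assumes "m > 0"
  shows "\<exists>T :: complex poly. coeff T 0 = 1 \<and> degree T \<le> K \<and> monom 1 (K + 1) dvd T ^ m - [:1, 1:]"
proof (induction K)
  case 0
  have "1 - [:1, 1:] = monom 1 1 * [:-1 :: complex:]" by (simp add: monom_altdef one_pCons)
  then show ?case by (intro exI[of _ 1]) auto
next
  case (Suc K)
  then obtain T Q :: "complex poly" where T: "coeff T 0 = 1" "degree T \<le> K"
      "T ^ m - [:1, 1:] = monom 1 (K + 1) * Q" by (auto simp: dvd_def)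
  define c where "c = - coeff Q 0 / of_nat m"
  define b where "b = monom c (K + 1)"
  obtain z where z: "(T + b) ^ m = T ^ m + of_nat m * b * T ^ (m - 1) + b ^ 2 * z"
    using power_add_first_order by blast
  have b: "b = monom 1 (K + 1) * [:c:]" by (simp add: b_def smult_monom)
  have "coeff (Q + of_nat m * [:c:] * T ^ (m - 1)) 0 = 0"
    using assms T(1) by (simp add: coeff_mult_0 coeff_0_power c_def of_nat_poly)
  then obtain Q' where Q': "Q + of_nat m * [:c:] * T ^ (m - 1) = monom 1 1 * Q'"
    unfolding monom_altdef poly_0_coeff_0[symmetric] poly_eq_0_iff_dvd by (elim dvdE) simp
  have "(T + b) ^ m - [:1, 1:] = (T ^ m - [:1, 1:]) + of_nat m * b * T ^ (m - 1) + b ^ 2 * z"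
    by (simp add: z)
  also have "\<dots> = monom 1 (K + 1) * (Q + of_nat m * [:c:] * T ^ (m - 1)) + b ^ 2 * z"
    unfolding T(3) by (simp add: b algebra_simps)
  also have "\<dots> = monom 1 (Suc K + 1) * Q' + monom 1 (Suc K + 1) * (monom 1 K * [:c:] ^ 2 * z)"
    unfolding Q' b by (simp add: power2_eq_square mult_monom flip: mult.assoc)
  finally have "monom 1 (Suc K + 1) dvd (T + b) ^ m - [:1, 1:]"
    by (simp only: dvd_add dvd_triv_left)
  moreover have "coeff (T + b) 0 = 1" using T(1) by (simp add: b_def)
  moreover have "degree (T + b) \<le> Suc K"
    unfolding b_def using T(2) by (intro degree_add_le) (auto intro: order_trans[OF degree_monom_le])
  ultimately show ?case by (intro exI[of _ "T + b"] conjI)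
qed

text \<open>Put \<open>N = deg y\<close>. Dividing by \<open>a1 A\<close> gives
  \<open>W = 1 + \<epsilon> - \<rho>\<close>, where \<open>\<epsilon> = E / A\<close> has order at
  least \<open>n\<close> and \<open>\<rho> = q / (a1 A)\<close> has order at least
  \<open>2 N\<close>. If \<open>v\<close> is the root of \<open>W\<close> near 1, then
  \<open>u = y / v\<close> is an \<open>m\<close>-th root of \<open>(a1 / b) A\<close>. The
  \<open>m\<close>-th power of \<open>\<tau> = T(\<epsilon>)\<close> is
  \<open>1 + \<epsilon>\<close> up to order \<open>n (K + 1) \<ge> 2 N\<close>, so \<open>v\<close>
  and \<open>\<tau>\<close> agree up to order \<open>2 N\<close>. Multiplication by
  \<open>u\<close>, of order \<open>-N\<close>, leaves an error of order \<open>N\<close>.\<close>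

lemma root_approximation:
  fixes y A E q T :: "complex poly"
  assumes "m \<ge> 2" "b \<noteq> 0" "a1 \<noteq> 0" "A \<noteq> 0" "n > 0" "degree y > 0"
    and eq: "smult b (y ^ m) + q = smult a1 (A + E)"
    and degA: "degree A = m * degree y"
    and degq: "degree q \<le> (m - 2) * degree y"
    and degE: "degree E + n \<le> degree A"
    and K: "2 * degree y \<le> n * (K + 1)"
    and T: "coeff T 0 = 1" "monom 1 (K + 1) dvd T ^ m - [:1, 1:]"
  obtains u where "u \<noteq> 0" "u ^ m = fls_const (a1 / b) * at_inf A"
    "order_ge (int (degree y)) (at_inf y - u * poly_fls (at_inf E / at_inf A) T)"
proof -
  let ?N = "degree y"
  define \<epsilon> where "\<epsilon> = at_inf E / at_inf A"
  define \<tau> where "\<tau> = poly_fls \<epsilon> T"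
  define W where "W = fls_const (b / a1) * at_inf y ^ m / at_inf A"
  define \<rho> where "\<rho> = fls_const (1 / a1) * at_inf q / at_inf A"
  have nz: "at_inf A \<noteq> 0" "at_inf y \<noteq> 0" using assms by auto
  have "order_ge (- int (degree E) - fls_subdegree (at_inf A)) \<epsilon>"
    unfolding \<epsilon>_def by (intro order_ge_divide order_ge_at_inf nz) simp
  then have \<epsilon>: "order_ge (int n) \<epsilon>"
    by (rule order_ge_mono) (use degE in \<open>simp add: fls_subdegree_at_inf\<close>)
  have "order_ge (0 + (- int ((m - 2) * ?N)) - fls_subdegree (at_inf A)) \<rho>"
    unfolding \<rho>_def by (intro order_ge_divide order_ge_mult order_ge_at_inf nz degq) simp
  moreover have "m * ?N = (m - 2) * ?N + 2 * ?N"
  proof -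
    obtain k where "m = k + 2" using assms(1) by (metis add.commute le_iff_add)
    then show ?thesis by (simp add: add_mult_distrib)
  qed
  ultimately have \<rho>: "order_ge (int (2 * ?N)) \<rho>"
    by (simp add: fls_subdegree_at_inf degA del: of_nat_mult)
  have "fls_const b * at_inf y ^ m + at_inf q = fls_const a1 * (at_inf A + at_inf E)"
    using arg_cong[OF eq, of at_inf] by simp
  then have "fls_const (1 / a1) * (fls_const b * at_inf y ^ m + at_inf q) =
      fls_const (1 / a1) * fls_const a1 * (at_inf A + at_inf E)"
    by (simp only: mult.assoc)
  then have "fls_const (b / a1) * at_inf y ^ m + fls_const (1 / a1) * at_inf q = at_inf A + at_inf E"
    using assms(3) by (simp add: algebra_simps flip: mult.assoc)
  then have "W + \<rho> = (at_inf A + at_inf E) / at_inf A"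
    unfolding W_def \<rho>_def by (simp flip: add_divide_distrib)
  then have W: "W = 1 + \<epsilon> - \<rho>"
    using nz unfolding \<epsilon>_def by (simp add: add_divide_distrib eq_diff_eq)
  have "order_ge 1 (\<epsilon> - \<rho>)"
    using \<epsilon> \<rho> assms(5,6) by (intro order_ge_diff) (auto elim!: order_ge_mono)
  then have "order_ge 1 (W - 1)" by (simp add: W)
  then obtain v where v: "v ^ m = W" "order_ge 1 (v - 1)"
    using one_unit_root[of W m] assms(1) by auto
  have v0: "v \<noteq> 0" "fls_subdegree v = 0" using near_const_unit[of v 1] v by simp_all
  define u where "u = at_inf y / v"
  have u: "u \<noteq> 0" "fls_subdegree u = - int ?N"
    using nz v0 by (simp_all add: u_def fls_subdegree_at_inf divide_inverse)
  have "u ^ m = at_inf y ^ m / W" by (simp add: u_def power_divide v)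
  also have "\<dots> = fls_const (a1 / b) * at_inf A"
  proof -
    have "fls_const (a1 / b) * fls_const (b / a1) = 1" using assms(2,3) by simp
    then have "at_inf y ^ m = fls_const (a1 / b) * at_inf A * W"
      using nz unfolding W_def by (simp flip: mult.assoc)
    moreover have "W \<noteq> 0" using nz assms(2,3) unfolding W_def by simp
    ultimately show ?thesis by simp
  qed
  finally have um: "u ^ m = fls_const (a1 / b) * at_inf A" .
  have \<epsilon>1: "order_ge 1 \<epsilon>" using \<epsilon> assms(5) by (auto elim!: order_ge_mono)
  have \<tau>: "order_ge 1 (\<tau> - 1)" unfolding \<tau>_def by (rule order_ge_poly_fls_1[OF \<epsilon>1 T(1)])
  obtain Q where "T ^ m - [:1, 1:] = monom 1 (K + 1) * Q" using T(2) by (auto simp: dvd_def)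
  from arg_cong[OF this, of "poly_fls \<epsilon>"]
  have \<tau>m: "\<tau> ^ m = 1 + \<epsilon> + \<epsilon> ^ (K + 1) * poly_fls \<epsilon> Q"
    by (simp add: \<tau>_def monom_altdef algebra_simps)
  have "order_ge (int (K + 1) * int n + 0) (\<epsilon> ^ (K + 1) * poly_fls \<epsilon> Q)"
    by (intro order_ge_mult order_ge_power order_ge_poly_fls \<epsilon>) (rule order_ge_mono[OF \<epsilon>1], simp)
  then have Q: "order_ge (int (2 * ?N)) (\<epsilon> ^ (K + 1) * poly_fls \<epsilon> Q)"
    by (rule order_ge_mono) (use K in \<open>simp only: of_nat_mult[symmetric] of_nat_le_iff add_0_right mult.commute\<close>)
  then have diff: "order_ge (int (2 * ?N)) (v ^ m - \<tau> ^ m)"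
  proof -
    have "v ^ m - \<tau> ^ m = - (\<rho> + \<epsilon> ^ (K + 1) * poly_fls \<epsilon> Q)"
      by (simp only: v(1) W \<tau>m) simp
    then show ?thesis using order_ge_uminus[OF order_ge_add[OF \<rho> Q]] by (simp only:)
  qed
  \<comment> \<open>\<open>U\<close> is the cofactor in
    \<open>v^m - \<tau>^m = (v - \<tau>) U\<close>. Each of its \<open>m\<close> summands is 1 plus
    terms of positive order, so \<open>U\<close> has constant term \<open>m\<close> and dividing by
    it preserves the order.\<close>
  define U where "U = (\<Sum>i<m. \<tau> ^ (m - Suc i) * v ^ i)"
  have "order_ge 1 (\<Sum>i<m. \<tau> ^ (m - Suc i) * v ^ i - 1)"
    by (intro order_ge_sum one_unit_mult one_unit_power \<tau> v)
  then have "order_ge 1 (U - fls_const (of_nat m))"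
    by (simp add: U_def sum_subtractf fls_of_nat)
  then have U: "U \<noteq> 0" "fls_subdegree U = 0" using near_const_unit[of U "of_nat m"] assms(1) by auto
  have "v - \<tau> = (v ^ m - \<tau> ^ m) / U"
    unfolding power_diff_sumr2[of v m \<tau>] U_def[symmetric] using U(1) by simp
  then have "order_ge (int (2 * ?N)) (v - \<tau>)" using order_ge_divide[OF diff U(1)] U(2) by simp
  moreover have "order_ge (- int ?N) u" using u by (simp add: order_ge_iff)
  ultimately have "order_ge (- int ?N + int (2 * ?N)) (u * (v - \<tau>))" by (intro order_ge_mult)
  moreover have "u * v = at_inf y" using v0 by (simp add: u_def)
  ultimately show ?thesis
    using that[of u] u um by (simp add: \<tau>_def \<epsilon>_def algebra_simps)
qed

text \<open>\<open>b\<close> matches the leading coefficient and \<open>c\<close> the next one.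
  After substituting \<open>h\<close>, the remainder lies \<open>2 deg h\<close> below the degree of
  \<open>g(h)\<close>; this gap drives the root approximation.\<close>

lemma complete_power:
  fixes g :: "complex poly"
  assumes "degree g = m" "m \<ge> 2"
  obtains b c q where "b \<noteq> 0" "degree q \<le> m - 2" "g = smult b ([:- c, 1:] ^ m) + q"
proof -
  define b where "b = lead_coeff g"
  have b: "b \<noteq> 0" using assms by (auto simp: b_def)
  define c where "c = - coeff g (m - 1) / (of_nat m * b)"
  define q where "q = g - smult b ([:- c, 1:] ^ m)"
  have deg: "degree ([:- c, 1:] ^ m) = m" by (rule degree_linear_power)
  have "coeff q i = 0" if "i > m - 2" for i
  proof -
    from that consider "i > m" | "i = m" | "i = m - 1" by linarith
    then show ?thesis
    proof cases
      case 1
      then show ?thesis using assms(1) deg by (simp add: q_def coeff_eq_0)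
    next
      case 2
      then show ?thesis using assms(1) by (simp add: q_def b_def coeff_linear_power)
    next
      case 3
      have "m choose (m - 1) = m" using assms(2) binomial_symmetric[of 1 m] by simp
      then have "coeff ([:- c, 1:] ^ m) (m - 1) = of_nat m * (- c)"
        using coeff_linear_poly_power[of "m - 1" m "- c" 1] assms(2) by simp
      then show ?thesis using 3 b assms(2) unfolding q_def c_def b_def[symmetric] by (simp only: coeff_diff coeff_smult) simp
    qed
  qed
  then have "degree q \<le> m - 2" by (intro degree_le) auto
  then show ?thesis by (rule that[OF b]) (simp add: q_def)
qed

section \<open>Spans of monomials\<close>

interpretation poly: vector_space "smult :: complex \<Rightarrow> complex poly \<Rightarrow> complex poly"
  by standard (simp_all add: algebra_simps smult_add_left smult_add_right)

text \<open>Homogeneous monomials of degree \<open>k\<close>. Homogeneity puts all products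
  \<open>E ^ k * A ^ (D - k)\<close> into one span, and the recursion yields the bound
  \<open>d ^ k\<close> on their number.\<close>

primrec monomials :: "nat \<Rightarrow> (nat \<Rightarrow> 'a :: comm_ring_1) \<Rightarrow> nat \<Rightarrow> 'a set" where
  "monomials d \<beta> 0 = {1}"
| "monomials d \<beta> (Suc k) = (\<lambda>(j, p). \<beta> j * p) ` ({1..d} \<times> monomials d \<beta> k)"

lemma monomials_SucI: "j \<in> {1..d} \<Longrightarrow> p \<in> monomials d \<beta> k \<Longrightarrow> \<beta> j * p \<in> monomials d \<beta> (Suc k)"
  by force

lemma finite_monomials [simp]: "finite (monomials d \<beta> k)"
  by (induction k) auto

lemma card_monomials: "card (monomials d \<beta> k) \<le> d ^ k"
proof (induction k)
  case (Suc k)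
  have "card (monomials d \<beta> (Suc k)) \<le> card ({1..d} \<times> monomials d \<beta> k)"
    unfolding monomials.simps by (rule card_image_le) simp
  also have "\<dots> \<le> d ^ Suc k" using Suc by (simp add: card_cartesian_product)
  finally show ?case .
qed simp

lemma monomials_exponents:
  assumes "p \<in> monomials d \<beta> k"
  shows "\<exists>e. (\<forall>j. e j \<le> k) \<and> p = (\<Prod>j=1..d. \<beta> j ^ e j)"
  using assms
proof (induction k arbitrary: p)
  case 0
  then show ?case by (intro exI[of _ "\<lambda>_. 0"]) simp
next
  case (Suc k)
  then obtain i q where i: "i \<in> {1..d}" "q \<in> monomials d \<beta> k" "p = \<beta> i * q" by auto
  with Suc.IH obtain e where e: "\<forall>j. e j \<le> k" "q = (\<Prod>j=1..d. \<beta> j ^ e j)" by blast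
  have "p = (\<Prod>j=1..d. \<beta> j ^ (e j + (if j = i then 1 else 0)))"
    using i by (simp add: power_add prod.distrib e(2) if_distrib[of "power _"] prod.delta mult.commute cong: if_cong)
  then show ?case using e(1) by (intro exI[of _ "\<lambda>j. e j + (if j = i then 1 else 0)"]) (auto intro: le_SucI)
qed

lemma span_monomials_mult:
  assumes "j \<in> {1..d}" "x \<in> poly.span (monomials d \<beta> k)"
  shows "\<beta> j * x \<in> poly.span (monomials d \<beta> (Suc k))"
  using assms(2)
proof (induction rule: poly.span_induct_alt)
  case base
  show ?case by (simp add: poly.span_zero)
next
  case (step c x y)
  then show ?case
    using poly.span_add[OF poly.span_scale[OF poly.span_base[OF monomials_SucI[OF assms(1) step(1)]], of c] step(2)]
    by (simp add: algebra_simps)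
qed

lemma power_in_span_monomials:
  assumes "j \<in> {1..d}" "x \<in> poly.span (monomials d \<beta> k)"
  shows "\<beta> j ^ i * x \<in> poly.span (monomials d \<beta> (i + k))"
  using assms by (induction i) (auto simp: mult.assoc intro: span_monomials_mult simp del: monomials.simps)

lemma linear_form_power_in_span_monomials:
  fixes c :: "nat \<Rightarrow> complex"
  assumes "x \<in> poly.span (monomials d \<beta> k)"
  shows "(\<Sum>j=1..d. smult (c j) (\<beta> j)) ^ i * x \<in> poly.span (monomials d \<beta> (i + k))"
  using assms
  by (induction i)
    (auto simp: mult.assoc sum_distrib_right simp del: monomials.simps
      intro!: poly.span_sum poly.span_scale span_monomials_mult)

text \<open>Over a fixed denominator \<open>q\<close> the numerators of logarithmic derivatives add
  under products and are only scaled by powers and roots, so \<open>b\<close> never grows. This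
  keeps the operators independent of \<open>n\<close>.\<close>

definition log_deriv_bound :: "complex poly \<Rightarrow> nat \<Rightarrow> complex fls \<Rightarrow> bool" where
  "log_deriv_bound q b t \<longleftrightarrow> (\<exists>p. degree p \<le> b \<and> at_inf q * deriv_x t = at_inf p * t)"

lemma log_deriv_bound_1 [simp]: "log_deriv_bound q b 1"
  unfolding log_deriv_bound_def by (intro exI[of _ 0]) simp

lemma log_deriv_bound_const [simp]: "log_deriv_bound q b (fls_const c)"
  unfolding log_deriv_bound_def by (intro exI[of _ 0]) simp

lemma log_deriv_bound_mult:
  assumes "log_deriv_bound q b t" "log_deriv_bound q b s"
  shows "log_deriv_bound q b (t * s)"
proof -
  obtain p1 p2 where "degree p1 \<le> b" "at_inf q * deriv_x t = at_inf p1 * t"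
    "degree p2 \<le> b" "at_inf q * deriv_x s = at_inf p2 * s"
    using assms unfolding log_deriv_bound_def by blast
  moreover have "at_inf q * deriv_x (t * s) = (at_inf q * deriv_x t) * s + (at_inf q * deriv_x s) * t"
    by (simp add: deriv_x_mult algebra_simps)
  ultimately show ?thesis
    unfolding log_deriv_bound_def by (intro exI[of _ "p1 + p2"]) (simp add: degree_add_le algebra_simps)
qed

lemma log_deriv_bound_power: "log_deriv_bound q b t \<Longrightarrow> log_deriv_bound q b (t ^ n)"
  by (induction n) (simp_all add: log_deriv_bound_mult)

lemma log_deriv_bound_inverse:
  assumes "log_deriv_bound q b t" "t \<noteq> 0"
  shows "log_deriv_bound q b (inverse t)"
proof -
  obtain p where p: "degree p \<le> b" "at_inf q * deriv_x t = at_inf p * t"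
    using assms unfolding log_deriv_bound_def by blast
  have "deriv_x (t * inverse t) = 0" using assms(2) by simp
  then have "t * deriv_x (inverse t) = - deriv_x t * inverse t"
    by (simp add: deriv_x_mult eq_neg_iff_add_eq_0 add.commute)
  from arg_cong[OF this, of "\<lambda>x. at_inf q * x"]
  have "t * (at_inf q * deriv_x (inverse t)) = - (at_inf q * deriv_x t) * inverse t"
    by (simp only: mult.left_commute[of t] mult_minus_left mult_minus_right mult.assoc)
  also have "\<dots> = t * (at_inf (- p) * inverse t)" by (simp add: p(2))
  finally have "at_inf q * deriv_x (inverse t) = at_inf (- p) * inverse t"
    by (rule mult_left_cancel[OF assms(2), THEN iffD1])
  then show ?thesis unfolding log_deriv_bound_def using p(1) by (intro exI[of _ "- p"]) simp
qed

text \<open>Since \<open>(t^m)' / t^m = m t' / t\<close>, passing to a root divides the numerator by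
  \<open>m\<close>. It is applied to \<open>u\<close>, which is known only through
  \<open>u ^ m\<close>.\<close>

lemma log_deriv_bound_root:
  assumes "log_deriv_bound q b (t ^ m)" "t \<noteq> 0" "m > 0"
  shows "log_deriv_bound q b t"
proof -
  obtain p where p: "degree p \<le> b" "at_inf q * deriv_x (t ^ m) = at_inf p * t ^ m"
    using assms unfolding log_deriv_bound_def by blast
  have d: "deriv_x (t ^ n) * t = fls_const (of_nat n) * t ^ n * deriv_x t" for n
  proof (induction n)
    case (Suc n)
    have "deriv_x (t ^ Suc n) * t = t * (deriv_x (t ^ n) * t) + t ^ Suc n * deriv_x t"
      by (simp add: deriv_x_mult algebra_simps)
    also have "\<dots> = (fls_const (of_nat n) + 1) * t ^ Suc n * deriv_x t"
      unfolding Suc by (simp add: algebra_simps)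
    also have "fls_const (of_nat n) + 1 = fls_const (of_nat (Suc n) :: complex)"
      by (simp flip: fls_plus_const)
    finally show ?case .
  qed simp
  have "t ^ m * (fls_const (of_nat m) * (at_inf q * deriv_x t)) = at_inf q * (deriv_x (t ^ m) * t)"
    unfolding d by (simp add: algebra_simps)
  also have "\<dots> = t ^ m * (at_inf p * t)" using p(2) by (simp add: algebra_simps)
  finally have "fls_const (of_nat m) * (at_inf q * deriv_x t) = at_inf p * t" using assms(2) by simp
  then have "fls_const (1 / of_nat m) * (fls_const (of_nat m) * (at_inf q * deriv_x t)) =
      fls_const (1 / of_nat m) * (at_inf p * t)" by simp
  then have "at_inf q * deriv_x t = at_inf (smult (1 / of_nat m) p) * t"
    using assms(3) by (simp add: mult.assoc[symmetric])
  then show ?thesis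
    unfolding log_deriv_bound_def using p(1)
    by (intro exI[of _ "smult (1 / of_nat m) p"]) (auto intro: order_trans[OF degree_smult_le])
qed

text \<open>The fraction \<open>f i' / f i\<close> is expanded by the remaining factors, so that all
  factors share one denominator and one degree bound.\<close>

lemma log_deriv_bound_factor:
  assumes "finite I" "i \<in> I" "\<And>j. j \<in> I \<Longrightarrow> f j \<noteq> 0"
  shows "log_deriv_bound (prod f I) (\<Sum>j\<in>I. degree (f j)) (at_inf (f i))"
proof -
  have eq: "prod f I = prod f (I - {i}) * f i" using assms(1,2) by (simp add: prod.remove mult.commute)
  have "degree (prod f (I - {i}) * pderiv (f i)) \<le> (\<Sum>j\<in>I - {i}. degree (f j)) + degree (f i)"
    using degree_prod_sum_le[of "I - {i}" f] assms(1) degree_pderiv[of "f i"]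
    by (intro order_trans[OF degree_mult_le] add_mono) auto
  also have "\<dots> = (\<Sum>j\<in>I. degree (f j))" using assms(1,2) by (simp add: sum.remove add.commute)
  finally show ?thesis
    unfolding log_deriv_bound_def eq
    by (intro exI[of _ "prod f (I - {i}) * pderiv (f i)"]) (simp add: deriv_x_at_inf algebra_simps)
qed

section \<open>The inner polynomial lies in the span\<close>

lemma pcompose_power: "pcompose (p ^ n) q = pcompose p q ^ n" for p q :: "'a :: comm_ring_1 poly"
  by (induction n) (simp_all add: pcompose_mult pcompose_1)

text \<open>With \<open>A = \<alpha> 1 ^ n\<close>, the root approximation and
  \<open>polynomial_near_span\<close> give \<open>h - c = u p / A^D\<close> exactly. The
  \<open>m\<close>-th power eliminates \<open>u\<close>, leaving an identity of polynomials that no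
  longer refers to Laurent series and can be carried over to the algebraic closure.\<close>

lemma composition_in_span:
  fixes \<alpha> :: "nat \<Rightarrow> complex poly" and a :: "nat \<Rightarrow> complex"
  assumes "m \<ge> 2" "d \<ge> 1" and a: "a 1 \<noteq> 0" and \<alpha>: "\<And>j. j \<in> {1..d} \<Longrightarrow> \<alpha> j \<noteq> 0"
    and dom: "\<And>j. j \<in> {2..d} \<Longrightarrow> degree (\<alpha> j) < degree (\<alpha> 1)"
    and D: "D = (\<Sum>j=1..d. degree (\<alpha> j))"
    and deg1: "degree (\<alpha> 1) > 0"
    and n: "n > m * D * 4 ^ (1 + d ^ D)"
    and G: "(\<Sum>j=1..d. smult (a j) (\<alpha> j ^ n)) = pcompose g h"
    and g: "degree g = m" and h: "degree h > 0"
  shows "\<exists>c \<kappa> p. p \<in> poly.span (monomials d (\<lambda>j. \<alpha> j ^ n) D) \<and> \<kappa> \<noteq> 0 \<and>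
    ((h - [:c:]) * \<alpha> 1 ^ (n * D)) ^ m = smult \<kappa> (\<alpha> 1 ^ n * p ^ m)"
proof -
  define \<beta> where "\<beta> = (\<lambda>j. \<alpha> j ^ n)"
  define A where "A = \<beta> 1"
  define E where "E = (\<Sum>j=2..d. smult (a j / a 1) (\<beta> j))"
  let ?N = "degree h"
  have one: "1 \<in> {1..d}" using assms(2) by simp
  have split: "{1..d} = insert 1 {2..d}" using assms(2) by auto
  have A0: "A \<noteq> 0" using \<alpha>[OF one] by (simp add: A_def \<beta>_def)
  have GA: "pcompose g h = smult (a 1) (A + E)"
    unfolding G[symmetric] split using a by (simp add: A_def E_def \<beta>_def smult_add_right poly.scale_sum_right)
  have "n > 0" using n by simp
  have degA: "degree A = n * degree (\<alpha> 1)" using \<alpha>[OF one] by (simp add: A_def \<beta>_def degree_power_eq)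
  have "degree E \<le> n * (degree (\<alpha> 1) - 1)"
    unfolding E_def
  proof (rule degree_sum_le)
    fix j assume "j \<in> {2..d}"
    then have "degree (\<alpha> j) \<le> degree (\<alpha> 1) - 1" using dom by force
    then have "degree (\<beta> j) \<le> n * (degree (\<alpha> 1) - 1)"
      unfolding \<beta>_def by (metis degree_power_le mult.commute mult_le_mono2 order_trans)
    then show "degree (smult (a j / a 1) (\<beta> j)) \<le> n * (degree (\<alpha> 1) - 1)"
      by (metis degree_smult_le order_trans)
  qed simp
  \<comment> \<open>Every other root has degree at least 1 less than \<open>\<alpha> 1\<close>, so
    its \<open>n\<close>-th power falls short by at least \<open>n\<close> degrees; hence
    \<open>E / A\<close> has order at least \<open>n\<close>.\<close>
  moreover have "n * (degree (\<alpha> 1) - 1) + n = n * degree (\<alpha> 1)"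
    using deg1 by (metis Suc_pred' add.commute mult_Suc_right)
  ultimately have degE: "degree E + n \<le> degree A" unfolding degA by linarith
  have "degree (A + E) = degree A" using degE \<open>n > 0\<close> by (intro degree_add_eq_left) linarith
  then have "degree (pcompose g h) = degree A" unfolding GA using a by simp
  then have degA': "degree A = m * ?N" using g by (simp add: degree_pcompose)
  have "n \<le> m * ?N" using deg1 degA degA' by (metis Suc_leI mult_le_mono2 nat_mult_1_right One_nat_def)
  have "degree (\<alpha> 1) \<le> D" unfolding D using one by (intro member_le_sum) auto
  then have "m * ?N \<le> n * D" using degA degA' by simp
  moreover have "2 * ?N \<le> m * ?N" using assms(1) by (rule mult_le_mono1)
  moreover have "n * D \<le> n * (D + 1)" by simp
  \<comment> \<open>Truncation at degree \<open>D\<close>, which is independent of \<open>n\<close>,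
    is enough: \<open>2 deg h \<le> m deg h = n deg (\<alpha> 1) \<le> n D\<close>.\<close>
  ultimately have K: "2 * ?N \<le> n * (D + 1)" by linarith
  obtain b c q where b: "b \<noteq> 0" "degree q \<le> m - 2" "g = smult b ([:- c, 1:] ^ m) + q"
    using complete_power[OF g assms(1)] .
  define y where "y = h - [:c:]"
  have degy: "degree y = ?N" unfolding y_def diff_conv_add_uminus using h by (intro degree_add_eq_left) simp
  have comp: "smult b (y ^ m) + pcompose q h = smult (a 1) (A + E)"
    unfolding GA[symmetric] b(3) y_def
    by (simp add: pcompose_add pcompose_smult pcompose_power pcompose_pCons diff_conv_add_uminus
        add.commute del: add_uminus_conv_diff)
  obtain T :: "complex poly" where T: "coeff T 0 = 1" "degree T \<le> D"
      "monom 1 (D + 1) dvd T ^ m - [:1, 1:]"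
    using truncated_root[of m D] assms(1) by auto
  obtain u where u: "u \<noteq> 0" "u ^ m = fls_const (a 1 / b) * at_inf A"
      "order_ge (int ?N) (at_inf y - u * poly_fls (at_inf E / at_inf A) T)"
  proof (rule root_approximation[where m = m and b = b and ?a1.0 = "a 1" and A = A and n = n
        and y = y and E = E and q = "pcompose q h" and K = D and T = T])
    show "degree (pcompose q h) \<le> (m - 2) * degree y" using b(2) by (simp add: degy degree_pcompose)
  qed (use assms(1) b(1) a A0 \<open>n > 0\<close> h comp degA' degE K T degy in auto)
  define M where "M = monomials d \<beta> D"
  define \<phi> where "\<phi> = (\<lambda>p. u * at_inf p / at_inf A ^ D)"
  interpret \<phi>: Vector_Spaces.linear "smult :: complex \<Rightarrow> _" "\<lambda>c f. fls_const c * f" \<phi>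
    by standard (simp_all add: \<phi>_def algebra_simps add_divide_distrib)
  \<comment> \<open>\<open>P\<close> equals \<open>A ^ D * T(E / A)\<close>, the homogenization of
    \<open>T\<close> to degree \<open>D\<close>.\<close>
  define P where "P = (\<Sum>k\<le>D. smult (coeff T k) (E ^ k * A ^ (D - k)))"
  have "E = (\<Sum>j=1..d. smult (if j = 1 then 0 else a j / a 1) (\<beta> j))"
    unfolding E_def split by (auto intro!: sum.cong)
  moreover have "A ^ (D - k) \<in> poly.span (monomials d \<beta> (D - k))" for k
    using power_in_span_monomials[OF one, of 1 \<beta> 0 "D - k"] by (simp add: A_def poly.span_base)
  ultimately have EA: "E ^ k * A ^ (D - k) \<in> poly.span M" if "k \<le> D" for k
    using linear_form_power_in_span_monomials[of "A ^ (D - k)" d \<beta> "D - k" "\<lambda>j. if j = 1 then 0 else a j / a 1" k] that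
    by (simp add: M_def)
  then have P: "P \<in> poly.span M"
    unfolding P_def by (intro poly.span_sum poly.span_scale) simp
  have "poly_fls (at_inf E / at_inf A) T = (\<Sum>k\<le>D. fls_const (coeff T k) * (at_inf E / at_inf A) ^ k)"
  proof -
    have "poly_fls (at_inf E / at_inf A) T =
        (\<Sum>k\<le>degree T. fls_const (coeff T k) * (at_inf E / at_inf A) ^ k)"
      by (simp add: poly_fls_def poly_altdef degree_map_poly coeff_map_poly)
    also have "\<dots> = (\<Sum>k\<le>D. fls_const (coeff T k) * (at_inf E / at_inf A) ^ k)"
      using T(2) by (intro sum.mono_neutral_left) (auto simp: coeff_eq_0)
    finally show ?thesis .
  qed
  also have "\<dots> = (\<Sum>k\<le>D. fls_const (coeff T k) * (at_inf E ^ k * at_inf A ^ (D - k))) / at_inf A ^ D"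
    unfolding sum_divide_distrib
  proof (intro sum.cong refl)
    fix k assume "k \<in> {..D}"
    then have "at_inf A ^ D = at_inf A ^ k * at_inf A ^ (D - k)" by (simp flip: power_add)
    then show "fls_const (coeff T k) * (at_inf E / at_inf A) ^ k =
        fls_const (coeff T k) * (at_inf E ^ k * at_inf A ^ (D - k)) / at_inf A ^ D"
      using A0 by (simp add: power_divide)
  qed
  also have "\<dots> = at_inf P / at_inf A ^ D" by (simp add: P_def poly_fls_sum)
  finally have uT: "u * poly_fls (at_inf E / at_inf A) T = \<phi> P" by (simp add: \<phi>_def)
  define R where "R = at_inf y - \<phi> P"
  have R: "order_ge (int ?N) R" using u(3) by (simp add: R_def uT)
  let ?Q = "prod \<alpha> {1..d}"
  have ld: "log_deriv_bound ?Q D (at_inf (\<beta> j))" if "j \<in> {1..d}" for j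
    unfolding \<beta>_def D poly_fls_power using that \<alpha>
    by (intro log_deriv_bound_power log_deriv_bound_factor) auto
  have ldm: "log_deriv_bound ?Q D (at_inf p)" if "p \<in> monomials d \<beta> k" for p k
    using that
  proof (induction k arbitrary: p)
    case (Suc k)
    then obtain j r where "j \<in> {1..d}" "r \<in> monomials d \<beta> k" "p = \<beta> j * r" by auto
    then show ?case using ld Suc.IH by (simp add: log_deriv_bound_mult)
  qed simp
  have "log_deriv_bound ?Q D (u ^ m)"
    unfolding u(2) A_def by (intro log_deriv_bound_mult log_deriv_bound_const ld one)
  then have ldu: "log_deriv_bound ?Q D u" using u(1) assms(1) by (auto intro: log_deriv_bound_root)
  have ld\<phi>: "log_deriv_bound ?Q D (\<phi> p)" if "p \<in> M" for p
    unfolding \<phi>_def divide_inverse A_def using that ldm ldu A0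
    by (intro log_deriv_bound_mult log_deriv_bound_inverse log_deriv_bound_power ld one)
      (auto simp: M_def A_def)
  let ?S = "insert 1 (\<phi> ` M)"
  have finM: "finite M" by (simp add: M_def)
  have "at_inf h \<in> fls.span ?S"
  proof (rule polynomial_near_span)
    show "finite ?S" using finM by simp
    have "card (\<phi> ` M) \<le> d ^ D" 
      using card_image_le[OF finM, of \<phi>] card_monomials[of d \<beta> D] by (simp add: M_def)
    then show "card ?S \<le> 1 + d ^ D"
      using card_insert_le_m1[of "1 + d ^ D" "\<phi> ` M" 1] by simp
    show "\<exists>q p. q \<noteq> 0 \<and> degree q \<le> D \<and> degree p \<le> D \<and> at_inf q * deriv_x t = at_inf p * t"
      if "t \<in> ?S" for t
    proof -
      have "log_deriv_bound ?Q D t" using that ld\<phi> by auto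
      moreover have "?Q \<noteq> 0" using \<alpha> by simp
      moreover have "degree ?Q \<le> D" unfolding D using degree_prod_sum_le[of "{1..d}" \<alpha>] by (simp add: o_def)
      ultimately show ?thesis unfolding log_deriv_bound_def by blast
    qed
    have "at_inf h - R = fls_const c * 1 + \<phi> P" by (simp add: R_def y_def)
    moreover have "\<phi> P \<in> fls.span (\<phi> ` M)" using P by (simp add: \<phi>.span_image)
    ultimately show "at_inf h - R \<in> fls.span ?S" unfolding fls.span_breakdown_eq by (intro exI[of _ c]) simp
    show "order_ge (int ?N) R" by (rule R)
    \<comment> \<open>The error \<open>R\<close> has order at least \<open>deg h\<close>, and
      \<open>n \<le> m deg h\<close> converts the lower bound on \<open>n\<close> into the required
      bound on that order. The exponent \<open>1 + d ^ D\<close> counts the generator 1 and the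
      monomials.\<close>
    have "m * (D * 4 ^ (1 + d ^ D)) < m * ?N" using n \<open>n \<le> m * ?N\<close> by (simp only: mult.assoc)
    then have "D * 4 ^ (1 + d ^ D) < ?N" by simp
    then show "int D * 4 ^ (1 + d ^ D) < int ?N" by (metis of_nat_less_iff of_nat_mult of_nat_numeral of_nat_power)
  qed
  then obtain k where "at_inf h - fls_const k * 1 \<in> \<phi> ` poly.span M"
    unfolding fls.span_breakdown_eq by (auto simp: \<phi>.span_image)
  then obtain p where p: "p \<in> poly.span M" "at_inf h - fls_const k = \<phi> p" by auto
  then have "at_inf (h - [:k:]) * at_inf A ^ D = u * at_inf p" using A0 by (simp add: \<phi>_def)
  then have "(at_inf (h - [:k:]) * at_inf A ^ D) ^ m = fls_const (a 1 / b) * at_inf A * at_inf p ^ m"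
    by (simp add: power_mult_distrib u(2))
  then have "at_inf (((h - [:k:]) * A ^ D) ^ m) = at_inf (smult (a 1 / b) (A * p ^ m))"
    by (simp add: algebra_simps)
  then have "((h - [:k:]) * A ^ D) ^ m = smult (a 1 / b) (A * p ^ m)" by (simp only: at_inf_eq_iff)
  then have "((h - [:k:]) * \<alpha> 1 ^ (n * D)) ^ m = smult (a 1 / b) (\<alpha> 1 ^ n * p ^ m)"
    by (simp add: A_def \<beta>_def power_mult)
  then show ?thesis using p(1) a b(1) unfolding M_def \<beta>_def
    by (intro exI[of _ k] exI[of _ "a 1 / b"] exI[of _ p]) simp
qed

section \<open>Fractions and the algebraic closure\<close>

interpretation fract: vector_space "\<lambda>c f. const_fract c * (f :: complex poly fract)"
proof
  have "const_fract (a + b) = const_fract a + const_fract b" for a b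
    by (simp flip: to_fract_add)
  then show "const_fract (a + b) * x = const_fract a * x + const_fract b * x" for a b x
    by (simp add: algebra_simps)
  have "const_fract (a * b) = const_fract a * const_fract b" for a b
    by (simp flip: to_fract_mult)
  then show "const_fract a * (const_fract b * x) = const_fract (a * b) * x" for a b x
    by (simp add: algebra_simps)
qed (simp_all add: algebra_simps flip: one_pCons)

lemma to_fract_power: "to_fract (p ^ n) = to_fract p ^ n"
  by (induction n) simp_all

lemma (in vector_space) span_image_finite_sum:
  assumes "finite I" "x \<in> span (f ` I)"
  shows "\<exists>c. x = (\<Sum>i\<in>I. scale (c i) (f i))"
  using assms(2)
proof (induction rule: span_induct_alt)
  case base
  show ?case by (intro exI[of _ "\<lambda>_. 0"]) simp
next
  case (step k y z)
  then obtain i c where i: "i \<in> I" "y = f i" and c: "z = (\<Sum>i\<in>I. scale (c i) (f i))" by auto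
  have "(\<Sum>j\<in>I. scale (c j + (if j = i then k else 0)) (f j)) =
      z + (\<Sum>j\<in>I. if j = i then scale (k) (f j) else 0)"
    unfolding c sum.distrib[symmetric] by (intro sum.cong refl) (simp add: scale_left_distrib)
  then have "scale (k) (y) + z = (\<Sum>j\<in>I. scale (c j + (if j = i then k else 0)) (f j))"
    using assms(1) i by (simp add: add.commute)
  then show ?case by (intro exI[of _ "\<lambda>j. c j + (if j = i then k else 0)"])
qed

text \<open>Polynomials are integrally closed: in lowest terms \<open>a / b\<close>, the denominator
  divides \<open>a ^ m\<close> and is coprime to it, hence is a unit.\<close>

lemma integral_fract_is_poly:
  fixes v :: "complex poly fract"
  assumes "v ^ m = to_fract p" "m > 0"
  shows "v \<in> range to_fract"
proof -
  define a where "a = fst (quot_of_fract v)"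
  define b where "b = snd (quot_of_fract v)"
  have b: "b \<noteq> 0" by (simp add: b_def)
  have v: "v = to_fract a / to_fract b"
    by (simp add: a_def b_def flip: Fract_conv_to_fract)
  have cop: "coprime a b" unfolding a_def b_def by (rule coprime_quot_of_fract)
  have "to_fract a = v * to_fract b" using b by (simp add: v)
  then have "to_fract a ^ m = to_fract p * to_fract b ^ m"
    by (simp add: power_mult_distrib assms(1))
  then have "to_fract (a ^ m) = to_fract (p * b ^ m)"
    by (simp add: to_fract_power)
  then have "a ^ m = p * b ^ m" by (simp only: to_fract_eq_iff)
  then have "b dvd a ^ m" using assms(2) by (metis dvd_power dvd_mult)
  moreover have "coprime b (a ^ m)" using cop by (simp add: coprime_commute)
  ultimately have "is_unit b" by (metis coprime_absorb_left)
  then obtain c where "b * c = 1" by (metis dvdE)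
  then have "to_fract b * to_fract c = 1" by (metis to_fract_1 to_fract_mult)
  then have "v = (to_fract a * to_fract c) / (to_fract b * to_fract c)"
    unfolding v by (metis mult_divide_mult_cancel_right mult_zero_right zero_neq_one)
  then have "v = to_fract (a * c)" using \<open>to_fract b * to_fract c = 1\<close> by simp
  then show ?thesis by blast
qed

section \<open>Rational powers of an m-th root\<close>

context
  fixes \<psi> :: "complex poly fract alg_closure" and \<alpha> :: "complex poly" and m :: nat
  assumes root: "\<psi> ^ m = poly_to_ac \<alpha>" and m: "m > 0"
begin

lemma least_poly_power_props:
  "least_poly_power \<psi> > 0" "\<psi> ^ least_poly_power \<psi> \<in> range poly_to_ac"
  using LeastI[of "\<lambda>k. k > 0 \<and> \<psi> ^ k \<in> range poly_to_ac" m] root m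
  unfolding least_poly_power_def by auto

text \<open>For \<open>r = n mod m0\<close> the power \<open>\<psi> ^ r\<close> is a quotient of
  \<open>\<psi> ^ n\<close> by a power of \<open>\<psi> ^ m0\<close>, hence rational. Its
  \<open>m\<close>-th power \<open>\<alpha> ^ r\<close> is a polynomial, so it is itself a
  polynomial, and \<open>r > 0\<close> would contradict the minimality of \<open>m0\<close>.\<close>

lemma least_poly_power_dvd:
  assumes "\<psi> ^ n \<in> range to_ac" "\<alpha> \<noteq> 0"
  shows "least_poly_power \<psi> dvd n"
proof (rule ccontr)
  define m0 where "m0 = least_poly_power \<psi>"
  assume "\<not> least_poly_power \<psi> dvd n"
  then have r: "n mod m0 > 0" by (simp add: m0_def mod_greater_zero_iff_not_dvd)
  have "\<psi> \<noteq> 0" using root assms(2) m by (auto simp: zero_power)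
  obtain x where x: "\<psi> ^ n = to_ac x" using assms(1) by blast
  obtain p where p: "\<psi> ^ m0 = poly_to_ac p" using least_poly_power_props(2) by (auto simp: m0_def)
  have "\<psi> ^ n = (\<psi> ^ m0) ^ (n div m0) * \<psi> ^ (n mod m0)"
    by (simp flip: power_mult power_add)
  then have "\<psi> ^ (n mod m0) = to_ac (x / to_fract p ^ (n div m0))"
    using \<open>\<psi> \<noteq> 0\<close> x p by (metis nonzero_mult_div_cancel_left power_not_zero to_ac_divide to_ac_power)
  moreover from this have "(x / to_fract p ^ (n div m0)) ^ m = to_fract (\<alpha> ^ (n mod m0))"
  proof -
    assume eq: "\<psi> ^ (n mod m0) = to_ac (x / to_fract p ^ (n div m0))"
    have "to_ac ((x / to_fract p ^ (n div m0)) ^ m) = (\<psi> ^ m) ^ (n mod m0)"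
      unfolding to_ac_power eq[symmetric] by (simp add: mult.commute flip: power_mult)
    also have "\<dots> = to_ac (to_fract (\<alpha> ^ (n mod m0)))" by (simp add: root to_fract_power)
    finally show ?thesis by (simp only: to_ac_eq_iff)
  qed
  then have "x / to_fract p ^ (n div m0) \<in> range to_fract" by (rule integral_fract_is_poly[OF _ m])
  ultimately have "\<psi> ^ (n mod m0) \<in> range poly_to_ac" by (metis rangeE rangeI)
  then have "m0 \<le> n mod m0" unfolding m0_def least_poly_power_def using r
    by (intro Least_le) (simp add: m0_def least_poly_power_def)
  moreover have "n mod m0 < m0" using least_poly_power_props(1) by (simp add: m0_def)
  ultimately show False by simp
qed

lemma of_ac_least_poly_power: "to_ac (of_ac (\<psi> ^ least_poly_power \<psi>)) = \<psi> ^ least_poly_power \<psi>"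
  using least_poly_power_props(2) by auto

end

section \<open>Roots of unity and equality of m-th powers\<close>

lemma const_ac_power: "poly_to_ac [:z:] ^ k = poly_to_ac [:z ^ k:]"
  by (simp only: poly_const_pow[symmetric] to_fract_power to_ac_power)

text \<open>The complex numbers already contain \<open>m\<close> solutions of
  \<open>z ^ m = 1\<close>, and no field has more.\<close>

lemma roots_of_unity_constant:
  fixes \<omega> :: "complex poly fract alg_closure"
  assumes "\<omega> ^ m = 1" "m > 0"
  shows "\<exists>z. z \<noteq> 0 \<and> \<omega> = poly_to_ac [:z:]"
proof -
  let ?R = "{\<omega> :: complex poly fract alg_closure. \<omega> ^ m = 1}"
  let ?Z = "{z :: complex. z ^ m = 1}"
  have "(\<lambda>z. poly_to_ac [:z:]) ` ?Z = ?R"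
  proof (rule card_seteq)
    let ?p = "monom 1 m - 1 :: complex poly fract alg_closure poly"
    have "coeff ?p m = 1" using assms(2) by (simp add: one_pCons coeff_pCons split: nat.split)
    then have "?p \<noteq> 0" by (metis coeff_0 zero_neq_one)
    have R: "?R = {x. poly ?p x = 0}" by (simp add: poly_monom)
    show fin: "finite ?R" unfolding R by (rule poly_roots_finite) fact
    have "degree ?p \<le> m" by (intro degree_diff_le) (simp_all add: degree_monom_le)
    then have "card ?R \<le> m" unfolding R using card_poly_roots_bound[OF \<open>?p \<noteq> 0\<close>] by simp
    show "(\<lambda>z. poly_to_ac [:z:]) ` ?Z \<subseteq> ?R" by (auto simp: const_ac_power simp flip: one_pCons)
    have "card ((\<lambda>z. poly_to_ac [:z:]) ` ?Z) = card ?Z" by (rule card_image) (auto simp: inj_on_def)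
    also have "\<dots> = m" using assms(2) by (simp add: card_roots_unity_eq)
    finally show "card ?R \<le> card ((\<lambda>z. poly_to_ac [:z:]) ` ?Z)"
      using \<open>card ?R \<le> m\<close> by simp
  qed
  then obtain z where "z ^ m = 1" "\<omega> = poly_to_ac [:z:]" using assms(1) by blast
  moreover from this have "z \<noteq> 0" using assms(2) by (auto simp: zero_power)
  ultimately show ?thesis by blast
qed

text \<open>\<open>\<kappa>\<close> has a complex \<open>m\<close>-th root \<open>k\<close>, so
  \<open>x / (k y)\<close> is a root of unity and therefore constant.\<close>

lemma equal_powers_up_to_constant:
  fixes x y :: "complex poly fract alg_closure"
  assumes "x ^ m = poly_to_ac [:\<kappa>:] * y ^ m" "m > 0" "\<kappa> \<noteq> 0" "y \<noteq> 0"
  shows "\<exists>z. z \<noteq> 0 \<and> x = poly_to_ac [:z:] * y"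
proof -
  obtain k where k: "k ^ m = \<kappa>"
    using bij_betwE[OF bij_betw_nth_root_unity[OF assms(3,2)], THEN bspec, of 1] by auto
  then have k0: "k \<noteq> 0" using assms(2,3) by auto
  let ?y = "poly_to_ac [:k:] * y"
  have y0: "?y \<noteq> 0" using k0 assms(4) by simp
  have "x ^ m = ?y ^ m"
    unfolding assms(1) k[symmetric] power_mult_distrib
    by (simp add: const_ac_power)
  then have "(x / ?y) ^ m = 1" using y0 by (simp add: power_divide)
  then obtain z where z: "z \<noteq> 0" "x / ?y = poly_to_ac [:z:]"
    using roots_of_unity_constant assms(2) by blast
  then have "x = poly_to_ac [:z:] * ?y" using y0 by (simp add: field_simps)
  also have "poly_to_ac [:z:] * poly_to_ac [:k:] = poly_to_ac [:z * k:]"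
    by (simp flip: to_ac_mult to_fract_mult)
  then have "poly_to_ac [:z:] * ?y = poly_to_ac [:z * k:] * y" by (simp only: mult.assoc[symmetric])
  finally show ?thesis using z k0 by (intro exI[of _ "z * k"]) simp
qed

section \<open>The generators\<close>

text \<open>
  The base \<open>D + 1\<close> digits of \<open>i\<close> encode the exponents of \<open>\<psi>\<^bsup>m0\<^esup>\<close> (digit 0) and of the \<open>\<alpha> j\<close>. The shift by
  \<open>m0 * D\<close> at \<open>j = 1\<close> comes from the common denominator of \<open>\<epsilon>\<^sup>0, \<dots>, \<epsilon>\<^sup>D\<close>.
\<close>

definition gen_exponent :: "nat \<Rightarrow> nat \<Rightarrow> nat \<Rightarrow> nat \<Rightarrow> int" where
  "gen_exponent m0 D i j =
    int ((if j = 0 then 1 else m0) * digit (Suc D) i j) - int (if j = 1 then m0 * D else 0)"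

text \<open>Every exponent vector bounded by \<open>D\<close> is the digit vector of some index; the
  negative shift at \<open>j = 1\<close> becomes the denominator.\<close>

lemma generator_with_exponents:
  fixes \<alpha> :: "nat \<Rightarrow> complex poly" and \<beta> :: "complex poly fract"
  assumes "d \<ge> 1" "\<And>j. j \<in> {1..d} \<Longrightarrow> \<alpha> j \<noteq> 0" "\<And>j. j \<le> d \<Longrightarrow> e j \<le> D"
  shows "\<exists>i\<in>{1..Suc D ^ (d + 1)}.
    \<beta> powi gen_exponent m0 D i 0 * (\<Prod>j=1..d. to_fract (\<alpha> j) powi gen_exponent m0 D i j) =
    \<beta> ^ e 0 * (\<Prod>j=1..d. to_fract (\<alpha> j) ^ (m0 * e j)) / to_fract (\<alpha> 1) ^ (m0 * D)"
proof -
  have "\<exists>i\<in>{1..Suc D ^ (d + 1)}. \<forall>j\<le>d. digit (Suc D) i j = e j"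
    by (rule ex_digits) (use assms(3) in \<open>simp add: less_Suc_eq_le\<close>)
  then obtain i where i: "i \<in> {1..Suc D ^ (d + 1)}" "\<And>j. j \<le> d \<Longrightarrow> digit (Suc D) i j = e j"
    by blast
  have "(\<Prod>j=1..d. to_fract (\<alpha> j) powi gen_exponent m0 D i j) =
      (\<Prod>j=1..d. to_fract (\<alpha> j) ^ (m0 * e j) / (if j = 1 then to_fract (\<alpha> 1) ^ (m0 * D) else 1))"
  proof (intro prod.cong refl)
    fix j assume j: "j \<in> {1..d}"
    then have "gen_exponent m0 D i j = int (m0 * e j) - int (if j = 1 then m0 * D else 0)"
      by (simp add: gen_exponent_def i(2))
    then have "to_fract (\<alpha> j) powi gen_exponent m0 D i j =
        to_fract (\<alpha> j) powi int (m0 * e j) / to_fract (\<alpha> j) powi int (if j = 1 then m0 * D else 0)"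
      using assms(2)[OF j] by (simp only: power_int_diff to_fract_eq_0_iff not_False_eq_True simp_thms)
    then show "to_fract (\<alpha> j) powi gen_exponent m0 D i j =
        to_fract (\<alpha> j) ^ (m0 * e j) / (if j = 1 then to_fract (\<alpha> 1) ^ (m0 * D) else 1)"
      by (simp only: power_int_of_nat) (simp split: if_splits)
  qed
  also have "\<dots> = (\<Prod>j=1..d. to_fract (\<alpha> j) ^ (m0 * e j)) / to_fract (\<alpha> 1) ^ (m0 * D)"
    unfolding prod_dividef using assms(1) by (simp add: prod.delta)
  moreover have "\<beta> powi gen_exponent m0 D i 0 = \<beta> ^ e 0"
    by (simp add: gen_exponent_def i(2) power_int_of_nat)
  ultimately show ?thesis using i(1) by (intro bexI[of _ i]) simp_all
qed

text \<open>Extracting the \<open>m\<close>-th root in \<open>composition_in_span\<close> gives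
  \<open>Y = z \<psi>^n p\<close> with a constant \<open>z\<close> and
  \<open>Y = (h - c) \<alpha>\<^sub>1^(n D)\<close>. So \<open>\<psi> ^ n\<close> is rational and
  \<open>n = m0 * ell\<close>. All exponents are now multiples of \<open>ell\<close>, and each term
  of \<open>h - c\<close> is the \<open>ell\<close>-th power of some \<open>\<gamma> i\<close> up to
  a constant.\<close>

lemma composition_in_generator_span:
  fixes \<alpha> :: "nat \<Rightarrow> complex poly" and a :: "nat \<Rightarrow> complex"
    and \<psi> :: "complex poly fract alg_closure"
  assumes "m \<ge> 2" "d \<ge> 1" and a: "a 1 \<noteq> 0" and \<alpha>: "\<And>j. j \<in> {1..d} \<Longrightarrow> \<alpha> j \<noteq> 0"
    and dom: "\<And>j. j \<in> {2..d} \<Longrightarrow> degree (\<alpha> j) < degree (\<alpha> 1)"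
    and D: "D = (\<Sum>j=1..d. degree (\<alpha> j))"
    and deg1: "degree (\<alpha> 1) > 0"
    and n: "n > m * D * 4 ^ (1 + d ^ D)"
    and G: "(\<Sum>j=1..d. smult (a j) (\<alpha> j ^ n)) = pcompose g h"
    and g: "degree g = m" and h: "degree h > 0"
    and \<psi>: "\<psi> ^ m = poly_to_ac (\<alpha> 1)" and m0: "m0 = least_poly_power \<psi>"
    and \<gamma>: "\<And>i. i \<in> {1..Suc D ^ (d + 1)} \<Longrightarrow> \<gamma> i = of_ac (\<psi> ^ m0) powi gen_exponent m0 D i 0 *
      (\<Prod>j=1..d. to_fract (\<alpha> j) powi gen_exponent m0 D i j)"
  shows "\<exists>ell. n = m0 * ell \<and>
    to_fract h \<in> fract.span ((\<lambda>i. \<gamma> i ^ ell) ` {1..Suc D ^ (d + 1)})"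
proof -
  let ?I = "{1..Suc D ^ (d + 1)}"
  have m: "m > 0" using assms(1) by simp
  have \<alpha>1: "\<alpha> 1 \<noteq> 0" using \<alpha> assms(2) by simp
  obtain c \<kappa> p where p: "p \<in> poly.span (monomials d (\<lambda>j. \<alpha> j ^ n) D)" "\<kappa> \<noteq> 0"
      "((h - [:c:]) * \<alpha> 1 ^ (n * D)) ^ m = smult \<kappa> (\<alpha> 1 ^ n * p ^ m)"
    using composition_in_span[OF assms(1-11)] by blast
  define Y where "Y = (h - [:c:]) * \<alpha> 1 ^ (n * D)"
  have "h \<noteq> [:c:]" using h by auto
  then have "Y \<noteq> 0" using \<alpha>1 by (simp add: Y_def)
  have Ym: "Y ^ m = [:\<kappa>:] * (\<alpha> 1 ^ n * p ^ m)" using p(3) by (simp add: Y_def)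
  \<comment> \<open>Here \<open>h\<close> being nonconstant enters: \<open>\<psi> ^ n\<close> is
    isolated below by dividing by \<open>p\<close>.\<close>
  have "p \<noteq> 0" using Ym \<open>Y \<noteq> 0\<close> m by (auto simp: zero_power)
  have "\<psi> \<noteq> 0" using \<psi> \<alpha>1 m by (auto simp: zero_power)
  have "poly_to_ac Y ^ m = poly_to_ac (Y ^ m)" by (simp add: to_fract_power)
  also have "\<dots> = poly_to_ac [:\<kappa>:] * (poly_to_ac (\<alpha> 1) ^ n * poly_to_ac p ^ m)"
    unfolding Ym by (simp only: to_fract_mult to_ac_mult to_fract_power to_ac_power)
  also have "poly_to_ac (\<alpha> 1) ^ n = (\<psi> ^ n) ^ m"
    unfolding \<psi>[symmetric] by (simp add: mult.commute flip: power_mult)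
  finally have "poly_to_ac Y ^ m = poly_to_ac [:\<kappa>:] * (\<psi> ^ n * poly_to_ac p) ^ m"
    by (simp only: power_mult_distrib)
  moreover have "\<psi> ^ n * poly_to_ac p \<noteq> 0" using \<open>\<psi> \<noteq> 0\<close> \<open>p \<noteq> 0\<close> by simp
  ultimately obtain z where z: "z \<noteq> 0" "poly_to_ac Y = poly_to_ac [:z:] * (\<psi> ^ n * poly_to_ac p)"
    using equal_powers_up_to_constant m p(2) by blast
  have "poly_to_ac [:z:] * poly_to_ac p \<noteq> 0" using z(1) \<open>p \<noteq> 0\<close> by simp
  then have "\<psi> ^ n = poly_to_ac Y / (poly_to_ac [:z:] * poly_to_ac p)"
    unfolding z(2) by (simp add: mult.left_commute)
  then have "\<psi> ^ n = to_ac (to_fract Y / (const_fract z * to_fract p))" by simp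
  then have "m0 dvd n" unfolding m0 by (intro least_poly_power_dvd[OF \<psi> m _ \<alpha>1]) blast
  then obtain ell where ell: "n = m0 * ell" by blast
  define \<beta> where "\<beta> = of_ac (\<psi> ^ m0)"
  have "\<psi> ^ n = to_ac (\<beta> ^ ell)"
    unfolding ell power_mult \<beta>_def m0 to_ac_power of_ac_least_poly_power[OF \<psi> m] ..
  then have "to_ac (to_fract Y) = to_ac (const_fract z * (\<beta> ^ ell * to_fract p))"
    unfolding z(2) by simp
  then have Y: "to_fract Y = const_fract z * (\<beta> ^ ell * to_fract p)" by (simp only: to_ac_eq_iff)
  define \<phi> where "\<phi> = (\<lambda>q. \<beta> ^ ell * to_fract q / to_fract (\<alpha> 1) ^ (n * D))"
  interpret \<phi>: Vector_Spaces.linear "smult :: complex \<Rightarrow> _" "\<lambda>c f. const_fract c * f" \<phi>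
  proof
    show "\<phi> (x + y) = \<phi> x + \<phi> y" for x y by (simp add: \<phi>_def algebra_simps add_divide_distrib)
    show "\<phi> (smult c x) = const_fract c * \<phi> x" for c x
    proof -
      have "smult c x = [:c:] * x" by simp
      then show ?thesis unfolding \<phi>_def by (simp only: to_fract_mult) (simp add: mult.left_commute)
    qed
  qed
  have gen: "\<exists>i\<in>?I. \<gamma> i = \<beta> ^ e 0 * (\<Prod>j=1..d. to_fract (\<alpha> j) ^ (m0 * e j)) / to_fract (\<alpha> 1) ^ (m0 * D)"
    if "\<And>j. j \<le> d \<Longrightarrow> e j \<le> D" for e
    using generator_with_exponents[of d \<alpha> e D \<beta> m0] assms(2) \<alpha> that \<gamma> unfolding \<beta>_def by (metis (no_types, lifting))
  \<comment> \<open>This makes 1 an admissible digit, so that \<open>e(0 := 1)\<close> below encodes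
    a generator with exactly one factor \<open>\<beta>\<close>.\<close>
  have "D \<ge> 1" using deg1 assms(2) unfolding D by (intro order_trans[OF _ member_le_sum[of 1]]) auto
  have "\<phi> q \<in> (\<lambda>i. \<gamma> i ^ ell) ` ?I" if q: "q \<in> monomials d (\<lambda>j. \<alpha> j ^ n) D" for q
  proof -
    obtain e where e: "\<And>j. e j \<le> D" "q = (\<Prod>j=1..d. (\<alpha> j ^ n) ^ e j)"
      using monomials_exponents[OF q] by blast
    obtain i where i: "i \<in> ?I" "\<gamma> i = \<beta> * (\<Prod>j=1..d. to_fract (\<alpha> j) ^ (m0 * e j)) / to_fract (\<alpha> 1) ^ (m0 * D)"
      using gen[of "e(0 := 1)"] e(1) \<open>D \<ge> 1\<close> by force
    have "to_fract q = (\<Prod>j=1..d. to_fract (\<alpha> j) ^ (m0 * e j)) ^ ell"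
    proof -
      have hom: "to_fract (prod f A) = (\<Prod>j\<in>A. to_fract (f j))" for f :: "nat \<Rightarrow> complex poly" and A
        by (induction A rule: infinite_finite_induct) simp_all
      show ?thesis
        unfolding e(2) hom prod_power_distrib
        by (intro prod.cong refl) (simp add: ell to_fract_power ac_simps flip: power_mult)
    qed
    then have "\<phi> q = \<gamma> i ^ ell"
      unfolding \<phi>_def i(2) power_divide power_mult_distrib ell by (simp add: ac_simps flip: power_mult)
    then show ?thesis using i(1) by blast
  qed
  then have "fract.span (\<phi> ` monomials d (\<lambda>j. \<alpha> j ^ n) D) \<subseteq> fract.span ((\<lambda>i. \<gamma> i ^ ell) ` ?I)"
    by (intro fract.span_mono) blast
  then have "\<phi> p \<in> fract.span ((\<lambda>i. \<gamma> i ^ ell) ` ?I)"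
    using p(1) by (auto simp: \<phi>.span_image)
  \<comment> \<open>The constant part of \<open>h\<close> needs a generator equal to 1: exponent 0
    at \<open>\<beta>\<close> and exponent \<open>D\<close> at \<open>\<alpha> 1\<close>, which
    cancels the denominator.\<close>
  moreover have "1 \<in> fract.span ((\<lambda>i. \<gamma> i ^ ell) ` ?I)"
  proof -
    have "(\<Prod>j=1..d. to_fract (\<alpha> j) ^ (m0 * (if j = 1 then D else 0))) =
        (\<Prod>j=1..d. if j = 1 then to_fract (\<alpha> 1) ^ (m0 * D) else 1)"
      by (intro prod.cong) auto
    also have "\<dots> = to_fract (\<alpha> 1) ^ (m0 * D)"
      using assms(2) by (simp add: prod.delta)
    finally obtain i where "i \<in> ?I" "\<gamma> i = 1"
      using gen[of "\<lambda>j. if j = 1 then D else 0"] \<alpha>1 by force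
    then show ?thesis by (intro fract.span_base) force
  qed
  ultimately have "const_fract c * 1 + const_fract z * \<phi> p \<in> fract.span ((\<lambda>i. \<gamma> i ^ ell) ` ?I)"
    by (intro fract.span_add fract.span_scale)
  moreover have "to_fract h = const_fract c * 1 + const_fract z * \<phi> p"
  proof -
    have "(to_fract h - const_fract c) * to_fract (\<alpha> 1) ^ (n * D) = const_fract z * (\<beta> ^ ell * to_fract p)"
      unfolding Y[symmetric] by (simp add: Y_def to_fract_power)
    then have "to_fract h - const_fract c = const_fract z * \<phi> p"
      unfolding \<phi>_def using \<alpha>1 by (simp add: eq_divide_eq)
    then show ?thesis by (simp add: diff_eq_eq add.commute)
  qed
  ultimately show ?thesis using ell by auto
qed

section \<open>Computable bounds and conclusion\<close>

theorem theorem1: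
  shows "\<exists>(C :: nat list \<Rightarrow> nat) (B :: nat list \<Rightarrow> nat) (E :: nat list \<Rightarrow> int).
    total_recursive 3 C \<and> total_recursive 3 B \<and> total_recursive_int 6 E \<and>
    (\<forall>(d :: nat) (m :: nat) (A :: nat \<Rightarrow> complex poly) (G :: nat \<Rightarrow> complex poly)
       (a :: nat \<Rightarrow> complex) (\<alpha> :: nat \<Rightarrow> complex poly)
       (\<psi> :: complex poly fract alg_closure) (D :: nat) (m0 :: nat).
      d \<ge> 2 \<longrightarrow> m \<ge> 2 \<longrightarrow>
      nondegenerate_simple_lrs d A G a \<alpha> \<longrightarrow>
      degree (\<alpha> 1) > Max ((\<lambda>i. degree (\<alpha> i)) ` {2..d}) \<longrightarrow>
      D = (\<Sum>i=1..d. degree (\<alpha> i)) \<longrightarrow>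
      \<psi> ^ m = poly_to_ac (\<alpha> 1) \<longrightarrow>
      m0 = least_poly_power \<psi> \<longrightarrow>
      C [m, d, D] > 0 \<and>
      (\<exists>(l :: nat) (\<gamma> :: nat \<Rightarrow> complex poly fract).
        l \<le> B [m, d, D] \<and>
        (\<forall>i\<in>{1..l}. \<gamma> i = of_ac (\<psi> ^ m0) powi E [m, m0, d, D, i, 0] *
            (\<Prod>j=1..d. to_fract (\<alpha> j) powi E [m, m0, d, D, i, j])) \<and>
        (\<forall>(n :: nat) (g :: complex poly) (h :: complex poly).
          n > C [m, d, D] \<longrightarrow> G n = pcompose g h \<longrightarrow> degree g = m \<longrightarrow> degree h > 1 \<longrightarrow>
          (\<exists>ell :: nat. n = m0 * ell \<and>
            (\<exists>c :: nat \<Rightarrow> complex.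
              to_fract h = (\<Sum>i=1..l. const_fract (c i) * \<gamma> i ^ ell))))))"
proof -
  \<comment> \<open>The threshold of \<open>composition_in_span\<close>; the successor makes
    \<open>C\<close> positive.\<close>
  have "recursive_fun 3 (\<lambda>xs. Suc (xs ! 0 * xs ! 2 * 4 ^ (1 + xs ! 1 ^ (xs ! 2))))"
    by (intro recursive_fun_intros; simp)
  then obtain C where C: "total_recursive 3 C"
      "\<And>xs. length xs = 3 \<Longrightarrow> C xs = Suc (xs ! 0 * xs ! 2 * 4 ^ (1 + xs ! 1 ^ (xs ! 2)))"
    unfolding recursive_fun_def by blast
  \<comment> \<open>The number of vectors of \<open>d + 1\<close> digits in base
    \<open>D + 1\<close>.\<close>
  have "recursive_fun 3 (\<lambda>xs. Suc (xs ! 2) ^ (xs ! 1 + 1))"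
    by (intro recursive_fun_intros; simp)
  then obtain B where B: "total_recursive 3 B"
      "\<And>xs. length xs = 3 \<Longrightarrow> B xs = Suc (xs ! 2) ^ (xs ! 1 + 1)"
    unfolding recursive_fun_def by blast
  \<comment> \<open>\<open>P\<close> and \<open>Q\<close> are the digit part and the shift of
    \<open>gen_exponent\<close>.\<close>
  have "recursive_fun 6 (\<lambda>xs. (if xs ! 5 = 0 then 1 else xs ! 1) *
      (xs ! 4 div Suc (xs ! 3) ^ (xs ! 5) mod Suc (xs ! 3)))"
    by (intro recursive_fun_intros; simp)
  then obtain P where P: "total_recursive 6 P"
      "\<And>xs. length xs = 6 \<Longrightarrow> P xs = (if xs ! 5 = 0 then 1 else xs ! 1) *
        (xs ! 4 div Suc (xs ! 3) ^ (xs ! 5) mod Suc (xs ! 3))"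
    unfolding recursive_fun_def by blast
  have "recursive_fun 6 (\<lambda>xs. if xs ! 5 = 1 then xs ! 1 * xs ! 3 else 0)"
    by (intro recursive_fun_intros; simp)
  then obtain Q where Q: "total_recursive 6 Q"
      "\<And>xs. length xs = 6 \<Longrightarrow> Q xs = (if xs ! 5 = 1 then xs ! 1 * xs ! 3 else 0)"
    unfolding recursive_fun_def by blast
  define E where "E = (\<lambda>xs. int (P xs) - int (Q xs))"
  have E: "E [m, m0, d, D, i, j] = gen_exponent m0 D i j" for m m0 d D i j
    unfolding E_def gen_exponent_def digit_def using P(2)[of "[m, m0, d, D, i, j]"] Q(2)[of "[m, m0, d, D, i, j]"] by simp
  show ?thesis
  proof (rule exI[of _ C], rule exI[of _ B], rule exI[of _ E], intro conjI allI impI)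
    show "total_recursive 3 C" "total_recursive 3 B" by fact+
    show "total_recursive_int 6 E" unfolding total_recursive_int_def E_def using P(1) Q(1) by blast
  next
    fix d m A G a \<alpha> \<psi> D m0
    show "C [m, d, D] > 0" using C(2)[of "[m, d, D]"] by simp
    assume d: "d \<ge> 2" and m: "m \<ge> 2" and lrs: "nondegenerate_simple_lrs d A G a \<alpha>"
      and dom: "degree (\<alpha> 1) > Max ((\<lambda>i. degree (\<alpha> i)) ` {2..d})"
      and D: "D = (\<Sum>i=1..d. degree (\<alpha> i))"
      and \<psi>: "\<psi> ^ m = poly_to_ac (\<alpha> 1)" and m0: "m0 = least_poly_power \<psi>"
    define \<gamma> where "\<gamma> = (\<lambda>i. of_ac (\<psi> ^ m0) powi gen_exponent m0 D i 0 *
      (\<Prod>j=1..d. to_fract (\<alpha> j) powi gen_exponent m0 D i j))"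
    let ?l = "Suc D ^ (d + 1)"
    have nd: "\<forall>i\<in>{1..d}. \<forall>j\<in>{1..d}. i \<noteq> j \<longrightarrow>
        to_fract (\<alpha> i) / to_fract (\<alpha> j) \<notin> range const_fract"
      using lrs by (simp add: nondegenerate_simple_lrs_def)
    have pow: "\<And>n. G n = (\<Sum>i=1..d. smult (a i) (\<alpha> i ^ n))"
      using lrs by (simp add: nondegenerate_simple_lrs_def)
    have a1: "a 1 \<noteq> 0" using lrs d by (simp add: nondegenerate_simple_lrs_def)
    have dom': "degree (\<alpha> j) < degree (\<alpha> 1)" if "j \<in> {2..d}" for j
      using dom that by (subst (asm) Max_less_iff) auto
    \<comment> \<open>A zero root divided by another root would be the constant 0, against
      non-degeneracy; \<open>d \<ge> 2\<close> provides the other index.\<close>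
    have \<alpha>: "\<alpha> j \<noteq> 0" if j: "j \<in> {1..d}" for j
    proof
      assume "\<alpha> j = 0"
      obtain k where k: "k \<in> {1..d}" "k \<noteq> j"
        using d that[of 1] that[of 2] by (cases "j = 1") auto
      have "to_fract (\<alpha> j) / to_fract (\<alpha> k) \<notin> range const_fract"
        using nd j k by metis
      moreover have "to_fract (\<alpha> j) / to_fract (\<alpha> k) = const_fract 0" using \<open>\<alpha> j = 0\<close> by simp
      ultimately show False by blast
    qed
    have deg1: "degree (\<alpha> 1) > 0" using dom'[of 2] d by simp
    show "\<exists>l \<gamma>. l \<le> B [m, d, D] \<and>
      (\<forall>i\<in>{1..l}. \<gamma> i = of_ac (\<psi> ^ m0) powi E [m, m0, d, D, i, 0] *
        (\<Prod>j=1..d. to_fract (\<alpha> j) powi E [m, m0, d, D, i, j])) \<and>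
      (\<forall>n g h. n > C [m, d, D] \<longrightarrow> G n = pcompose g h \<longrightarrow> degree g = m \<longrightarrow> degree h > 1 \<longrightarrow>
        (\<exists>ell. n = m0 * ell \<and> (\<exists>c. to_fract h = (\<Sum>i=1..l. const_fract (c i) * \<gamma> i ^ ell))))"
    proof (rule exI[of _ ?l], rule exI[of _ \<gamma>], intro conjI ballI allI impI)
      show "?l \<le> B [m, d, D]" using B(2)[of "[m, d, D]"] by simp
      show "\<gamma> i = of_ac (\<psi> ^ m0) powi E [m, m0, d, D, i, 0] *
        (\<Prod>j=1..d. to_fract (\<alpha> j) powi E [m, m0, d, D, i, j])" for i
        unfolding E \<gamma>_def ..
      fix n g h
      assume n: "n > C [m, d, D]" and G: "G n = pcompose g h" and g: "degree g = m" and h: "degree h > 1"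
      have large: "n > m * D * 4 ^ (1 + d ^ D)" using n C(2)[of "[m, d, D]"] by simp
      have sum: "(\<Sum>j=1..d. smult (a j) (\<alpha> j ^ n)) = pcompose g h"
        using pow G by simp
      have "\<exists>ell. n = m0 * ell \<and> to_fract h \<in> fract.span ((\<lambda>i. \<gamma> i ^ ell) ` {1..?l})"
        by (rule composition_in_generator_span[where a = a, OF m _ a1 \<alpha> dom' D deg1 large sum g _ \<psi> m0])
          (use d h in \<open>simp_all add: \<gamma>_def\<close>)
      then obtain ell where ell: "n = m0 * ell" "to_fract h \<in> fract.span ((\<lambda>i. \<gamma> i ^ ell) ` {1..?l})"
        by blast
      then show "\<exists>ell. n = m0 * ell \<and> (\<exists>c. to_fract h = (\<Sum>i=1..?l. const_fract (c i) * \<gamma> i ^ ell))"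
        using fract.span_image_finite_sum[OF _ ell(2)] by blast
    qed
  qed
qed

end
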